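(* Let $k$ be an algebraically closed field of characteristic $0$. The Jordan plane $J=k\langle X,Y:[X,Y]=Y^2\rangle$ is a coideal subalgebra of a connected Hopf $k$-algebra $H$ with $\operatorname{GKdim}H=3$.
   Context: A Hopf algebra $H$ with comultiplication $\Delta$ is connected if its coradical (the sum of its simple subcoalgebras) equals $k$. A left (respectively right) coideal subalgebra of $H$ is a subalgebra $T$ with $\Delta(T)\subseteq H\otimes T$ (respectively $\Delta(T)\subseteq T\otimes H$); a coideal subalgebra is a left or right one. The claim means that some such $H$ has a coideal subalgebra isomorphic to $J$ as a $k$-algebra. $[X,Y]=XY-YX$. *)

theory Defs
  imports
    "HOL-Algebra.Algebra"
    "HOL-Algebra.Algebraic_Closure_Type"
    "HOL-Library.Poly_Mapping"
    "HOL-Library.Extended_Real"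
    "HOL-Library.Liminf_Limsup"
begin

section \<open>Algebras and linear algebra over a field\<close>

text \<open>
  The base field is a type \<open>'k\<close>; vector spaces and algebras over it are records of type
  \<open>('k, 'a) module\<close> with explicit carriers.
\<close>

abbreviation base_field :: "'k::field ring" where
  "base_field \<equiv> ring_of_type_algebra"

text \<open>The locale \<open>algebra\<close> of the library only covers commutative algebras.\<close>

definition k_algebra :: "('k::field, 'a) module \<Rightarrow> bool" where
  "k_algebra A \<longleftrightarrow> ring A \<and> module base_field A \<and>
     (\<forall>c. \<forall>x \<in> carrier A. \<forall>y \<in> carrier A.
        (c \<odot>\<^bsub>A\<^esub> x) \<otimes>\<^bsub>A\<^esub> y = c \<odot>\<^bsub>A\<^esub> (x \<otimes>\<^bsub>A\<^esub> y) \<and>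
        x \<otimes>\<^bsub>A\<^esub> (c \<odot>\<^bsub>A\<^esub> y) = c \<odot>\<^bsub>A\<^esub> (x \<otimes>\<^bsub>A\<^esub> y))"

abbreviation subspace_of :: "'a set \<Rightarrow> ('k::field, 'a) module \<Rightarrow> bool" where
  "subspace_of V M \<equiv> submodule V base_field M"

definition lin_span :: "('k::field, 'a) module \<Rightarrow> 'a set \<Rightarrow> 'a set" where
  "lin_span M S = \<Inter>{N. subspace_of N M \<and> S \<subseteq> N}"

definition lin_indep :: "('k::field, 'a) module \<Rightarrow> 'a set \<Rightarrow> bool" where
  "lin_indep M B \<longleftrightarrow> B \<subseteq> carrier M \<and> (\<forall>b \<in> B. b \<notin> lin_span M (B - {b}))"

definition fin_dim :: "('k::field, 'a) module \<Rightarrow> 'a set \<Rightarrow> bool" where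
  "fin_dim M V \<longleftrightarrow> (\<exists>B. finite B \<and> B \<subseteq> carrier M \<and> lin_span M B = V)"

definition vdim :: "('k::field, 'a) module \<Rightarrow> 'a set \<Rightarrow> nat" where
  "vdim M V = card (SOME B. lin_indep M B \<and> lin_span M B = V)"

definition linear_map :: "('k::field, 'a) module \<Rightarrow> ('k, 'b) module \<Rightarrow> ('a \<Rightarrow> 'b) \<Rightarrow> bool" where
  "linear_map M N f \<longleftrightarrow> f \<in> carrier M \<rightarrow> carrier N \<and>
     (\<forall>x \<in> carrier M. \<forall>y \<in> carrier M. f (x \<oplus>\<^bsub>M\<^esub> y) = f x \<oplus>\<^bsub>N\<^esub> f y) \<and>
     (\<forall>c. \<forall>x \<in> carrier M. f (c \<odot>\<^bsub>M\<^esub> x) = c \<odot>\<^bsub>N\<^esub> f x)"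

definition algebra_isomorphic :: "('k::field, 'a) module \<Rightarrow> ('k, 'b) module \<Rightarrow> bool" where
  "algebra_isomorphic A B \<longleftrightarrow> (\<exists>f. f \<in> ring_iso A B \<and> linear_map A B f)"

definition quotient_algebra :: "('k::field, 'a) module \<Rightarrow> 'a set \<Rightarrow> ('k, 'a set) module" where
  "quotient_algebra A I =
     \<lparr> carrier = carrier (A Quot I), monoid.mult = monoid.mult (A Quot I),
       monoid.one = monoid.one (A Quot I),
       ring.zero = ring.zero (A Quot I), add = ring.add (A Quot I),
       module.smult = (\<lambda>c Q. \<Union>x \<in> Q. I +>\<^bsub>A\<^esub> (c \<odot>\<^bsub>A\<^esub> x)) \<rparr>"

text \<open>
  The monoid algebra \<open>k[G]\<close>. As a vector space it is the free vector space on
  the carrier of \<open>G\<close>.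
\<close>

definition monoid_algebra :: "('g, 'm) monoid_scheme \<Rightarrow> ('k::field, 'g \<Rightarrow>\<^sub>0 'k) module" where
  "monoid_algebra G =
     \<lparr> carrier = {p. Poly_Mapping.keys p \<subseteq> carrier G},
       monoid.mult = (\<lambda>p q. \<Sum>x \<in> Poly_Mapping.keys p. \<Sum>y \<in> Poly_Mapping.keys q.
                 Poly_Mapping.single (x \<otimes>\<^bsub>G\<^esub> y) (Poly_Mapping.lookup p x * Poly_Mapping.lookup q y)),
       one = Poly_Mapping.single \<one>\<^bsub>G\<^esub> 1,
       ring.zero = 0,
       add = (+),
       module.smult = (\<lambda>c. Poly_Mapping.map ((*) c)) \<rparr>"


section \<open>Tensor products\<close>

definition tensor_relations ::
  "('k::field, 'a) module \<Rightarrow> ('k, 'b) module \<Rightarrow> ('a \<times> 'b \<Rightarrow>\<^sub>0 'k) set" where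
  "tensor_relations A B =
     {Poly_Mapping.single (x \<oplus>\<^bsub>A\<^esub> x', y) 1 - Poly_Mapping.single (x, y) 1
        - Poly_Mapping.single (x', y) 1
        | x x' y. x \<in> carrier A \<and> x' \<in> carrier A \<and> y \<in> carrier B} \<union>
     {Poly_Mapping.single (x, y \<oplus>\<^bsub>B\<^esub> y') 1 - Poly_Mapping.single (x, y) 1
        - Poly_Mapping.single (x, y') 1
        | x y y'. x \<in> carrier A \<and> y \<in> carrier B \<and> y' \<in> carrier B} \<union>
     {Poly_Mapping.single (c \<odot>\<^bsub>A\<^esub> x, y) 1 - Poly_Mapping.single (x, y) c
        | c x y. x \<in> carrier A \<and> y \<in> carrier B} \<union>
     {Poly_Mapping.single (x, c \<odot>\<^bsub>B\<^esub> y) 1 - Poly_Mapping.single (x, y) c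
        | c x y. x \<in> carrier A \<and> y \<in> carrier B}"

definition tensor_null ::
  "('k::field, 'a) module \<Rightarrow> ('k, 'b) module \<Rightarrow> ('a \<times> 'b \<Rightarrow>\<^sub>0 'k) set" where
  "tensor_null A B = lin_span (monoid_algebra (A \<times>\<times> B)) (tensor_relations A B)"

text \<open>
  The free vector space on pairs modulo the bilinearity relations. For algebras \<open>A\<close>, \<open>B\<close> the
  span of the relations is a two-sided ideal of the monoid algebra of \<open>A \<times> B\<close>, and the quotient
  carries the usual product \<open>(a \<otimes> b)(a' \<otimes> b') = aa' \<otimes> bb'\<close>.
\<close>

definition tensor ::
  "('k::field, 'a) module \<Rightarrow> ('k, 'b) module \<Rightarrow> ('k, ('a \<times> 'b \<Rightarrow>\<^sub>0 'k) set) module" where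
  "tensor A B = quotient_algebra (monoid_algebra (A \<times>\<times> B)) (tensor_null A B)"

definition pure_tensor ::
  "('k::field, 'a) module \<Rightarrow> ('k, 'b) module \<Rightarrow> 'a \<Rightarrow> 'b \<Rightarrow> ('a \<times> 'b \<Rightarrow>\<^sub>0 'k) set" where
  "pure_tensor A B x y =
     tensor_null A B +>\<^bsub>monoid_algebra (A \<times>\<times> B)\<^esub> Poly_Mapping.single (x, y) 1"

text \<open>
  The linear map into \<open>P\<close> induced by a bilinear map \<open>\<beta>\<close>. For bilinear \<open>\<beta>\<close>
  the result does not depend on the representative chosen.
\<close>

definition tensor_lift ::
  "('k::field, 'c) module \<Rightarrow> ('a \<Rightarrow> 'b \<Rightarrow> 'c) \<Rightarrow> ('a \<times> 'b \<Rightarrow>\<^sub>0 'k) set \<Rightarrow> 'c" where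
  "tensor_lift P \<beta> t =
     (let p = (SOME p. p \<in> t)
      in finsum P (\<lambda>(x, y). Poly_Mapping.lookup p (x, y) \<odot>\<^bsub>P\<^esub> \<beta> x y) (Poly_Mapping.keys p))"

text \<open>The map \<open>f \<otimes> g\<close> into the tensor product of \<open>A\<close> and \<open>B\<close>.\<close>

definition tensor_map ::
  "('k::field, 'c) module \<Rightarrow> ('k, 'd) module \<Rightarrow> ('a \<Rightarrow> 'c) \<Rightarrow> ('b \<Rightarrow> 'd) \<Rightarrow>
   ('a \<times> 'b \<Rightarrow>\<^sub>0 'k) set \<Rightarrow> ('c \<times> 'd \<Rightarrow>\<^sub>0 'k) set" where
  "tensor_map A B f g = tensor_lift (tensor A B) (\<lambda>x y. pure_tensor A B (f x) (g y))"

text \<open>The canonical map \<open>(A \<otimes> B) \<otimes> C \<rightarrow> A \<otimes> (B \<otimes> C)\<close>.\<close>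

definition tensor_assoc ::
  "('k::field, 'a) module \<Rightarrow> ('k, 'b) module \<Rightarrow> ('k, 'c) module \<Rightarrow>
   (('a \<times> 'b \<Rightarrow>\<^sub>0 'k) set \<times> 'c \<Rightarrow>\<^sub>0 'k) set \<Rightarrow> ('a \<times> ('b \<times> 'c \<Rightarrow>\<^sub>0 'k) set \<Rightarrow>\<^sub>0 'k) set" where
  "tensor_assoc A B C =
     tensor_lift (tensor A (tensor B C))
       (\<lambda>u z. tensor_lift (tensor A (tensor B C))
          (\<lambda>x y. pure_tensor A (tensor B C) x (pure_tensor B C y z)) u)"

text \<open>
  The image of \<open>V \<otimes> W\<close> in \<open>A \<otimes> B\<close> for subspaces \<open>V\<close> of \<open>A\<close> and \<open>W\<close> of \<open>B\<close>; over a field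
  it may be identified with \<open>V \<otimes> W\<close>.
\<close>

definition tensor_sub ::
  "('k::field, 'a) module \<Rightarrow> ('k, 'b) module \<Rightarrow> 'a set \<Rightarrow> 'b set \<Rightarrow> ('a \<times> 'b \<Rightarrow>\<^sub>0 'k) set set" where
  "tensor_sub A B V W = lin_span (tensor A B) {pure_tensor A B v w | v w. v \<in> V \<and> w \<in> W}"


section \<open>Hopf algebras\<close>

locale hopf_algebra =
  fixes H :: "('k::field, 'a) module"
    and \<Delta> :: "'a \<Rightarrow> ('a \<times> 'a \<Rightarrow>\<^sub>0 'k) set"
    and \<epsilon> :: "'a \<Rightarrow> 'k"
    and S :: "'a \<Rightarrow> 'a"
  assumes algebra: "k_algebra H"
    and comult_linear: "linear_map H (tensor H H) \<Delta>"
    and comult_hom: "\<Delta> \<in> ring_hom H (tensor H H)"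
    and counit_linear: "\<And>c x. x \<in> carrier H \<Longrightarrow> \<epsilon> (c \<odot>\<^bsub>H\<^esub> x) = c * \<epsilon> x"
    and counit_hom: "\<epsilon> \<in> ring_hom H base_field"
    and antipode_linear: "linear_map H H S"
    and coassoc: "\<And>h. h \<in> carrier H \<Longrightarrow>
      tensor_assoc H H H (tensor_map (tensor H H) H \<Delta> id (\<Delta> h)) =
      tensor_map H (tensor H H) id \<Delta> (\<Delta> h)"
    and counit_left: "\<And>h. h \<in> carrier H \<Longrightarrow> tensor_lift H (\<lambda>x y. \<epsilon> x \<odot>\<^bsub>H\<^esub> y) (\<Delta> h) = h"
    and counit_right: "\<And>h. h \<in> carrier H \<Longrightarrow> tensor_lift H (\<lambda>x y. \<epsilon> y \<odot>\<^bsub>H\<^esub> x) (\<Delta> h) = h"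
    and antipode_left: "\<And>h. h \<in> carrier H \<Longrightarrow>
      tensor_lift H (\<lambda>x y. S x \<otimes>\<^bsub>H\<^esub> y) (\<Delta> h) = \<epsilon> h \<odot>\<^bsub>H\<^esub> \<one>\<^bsub>H\<^esub>"
    and antipode_right: "\<And>h. h \<in> carrier H \<Longrightarrow>
      tensor_lift H (\<lambda>x y. x \<otimes>\<^bsub>H\<^esub> S y) (\<Delta> h) = \<epsilon> h \<odot>\<^bsub>H\<^esub> \<one>\<^bsub>H\<^esub>"

definition subcoalgebra ::
  "('k::field, 'a) module \<Rightarrow> ('a \<Rightarrow> ('a \<times> 'a \<Rightarrow>\<^sub>0 'k) set) \<Rightarrow> 'a set \<Rightarrow> bool" where
  "subcoalgebra H \<Delta> C \<longleftrightarrow> subspace_of C H \<and> \<Delta> ` C \<subseteq> tensor_sub H H C C"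

definition simple_subcoalgebra ::
  "('k::field, 'a) module \<Rightarrow> ('a \<Rightarrow> ('a \<times> 'a \<Rightarrow>\<^sub>0 'k) set) \<Rightarrow> 'a set \<Rightarrow> bool" where
  "simple_subcoalgebra H \<Delta> C \<longleftrightarrow> subcoalgebra H \<Delta> C \<and> C \<noteq> {\<zero>\<^bsub>H\<^esub>} \<and>
     (\<forall>D. subcoalgebra H \<Delta> D \<and> D \<subseteq> C \<longrightarrow> D = {\<zero>\<^bsub>H\<^esub>} \<or> D = C)"

definition coradical ::
  "('k::field, 'a) module \<Rightarrow> ('a \<Rightarrow> ('a \<times> 'a \<Rightarrow>\<^sub>0 'k) set) \<Rightarrow> 'a set" where
  "coradical H \<Delta> = lin_span H (\<Union>{C. simple_subcoalgebra H \<Delta> C})"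

definition connected_hopf ::
  "('k::field, 'a) module \<Rightarrow> ('a \<Rightarrow> ('a \<times> 'a \<Rightarrow>\<^sub>0 'k) set) \<Rightarrow> bool" where
  "connected_hopf H \<Delta> \<longleftrightarrow> coradical H \<Delta> = {c \<odot>\<^bsub>H\<^esub> \<one>\<^bsub>H\<^esub> | c. True}"

definition coideal_subalgebra ::
  "('k::field, 'a) module \<Rightarrow> ('a \<Rightarrow> ('a \<times> 'a \<Rightarrow>\<^sub>0 'k) set) \<Rightarrow> 'a set \<Rightarrow> bool" where
  "coideal_subalgebra H \<Delta> T \<longleftrightarrow> subring T H \<and> subspace_of T H \<and>
     (\<Delta> ` T \<subseteq> tensor_sub H H (carrier H) T \<or> \<Delta> ` T \<subseteq> tensor_sub H H T (carrier H))"


section \<open>Gelfand--Kirillov dimension\<close>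

fun subspace_power :: "('k::field, 'a) module \<Rightarrow> 'a set \<Rightarrow> nat \<Rightarrow> 'a set" where
  "subspace_power A V 0 = lin_span A {\<one>\<^bsub>A\<^esub>}"
| "subspace_power A V (Suc n) = lin_span A {x \<otimes>\<^bsub>A\<^esub> y | x y. x \<in> subspace_power A V n \<and> y \<in> V}"

text \<open>
  The supremum over the finite-dimensional subspaces \<open>V\<close> of
  \<open>limsup log\<^sub>n dim (k + V + V\<^sup>2 + \<dots> + V\<^sup>n)\<close>.
\<close>

definition GKdim :: "('k::field, 'a) module \<Rightarrow> ereal" where
  "GKdim A = (SUP V \<in> {V. fin_dim A V}.
     limsup (\<lambda>n. ereal (log (real n) (real (vdim A (lin_span A (\<Union>i\<le>n. subspace_power A V i)))))))"


section \<open>The Jordan plane\<close>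

definition free_algebra :: "('k::field, 'x list \<Rightarrow>\<^sub>0 'k) module" where
  "free_algebra = monoid_algebra \<lparr> carrier = UNIV, monoid.mult = (@), one = [] \<rparr>"

definition free_gen :: "'x \<Rightarrow> ('x list \<Rightarrow>\<^sub>0 'k::field)" where
  "free_gen x = Poly_Mapping.single [x] 1"

datatype jordan_gen = JX | JY

definition jordan_plane :: "('k::field, (jordan_gen list \<Rightarrow>\<^sub>0 'k) set) module" where
  "jordan_plane =
     (let F = free_algebra; x = free_gen JX; y = free_gen JY
      in quotient_algebra F (Idl\<^bsub>F\<^esub> {(x \<otimes>\<^bsub>F\<^esub> y \<ominus>\<^bsub>F\<^esub> y \<otimes>\<^bsub>F\<^esub> x) \<ominus>\<^bsub>F\<^esub> y \<otimes>\<^bsub>F\<^esub> y}))"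

end

theory Submission
  imports Defs
begin

text \<open>
  Let \<open>H\<close> be generated by \<open>X, Y, Z\<close> with \<open>[X, Y] = Y\<close>, \<open>[X, Z] = Z\<close>, \<open>[Z, Y] = Y\<^sup>2 / 2\<close>, where \<open>X\<close> and \<open>Y\<close>
  are primitive and \<open>\<Delta> Z = Z \<otimes> 1 + 1 \<otimes> Z + X \<otimes> Y\<close>. Then \<open>2 Z\<close> and \<open>Y\<close> satisfy the Jordan relation, and
  since the right tensor factors of \<open>\<Delta> Y\<close> and \<open>\<Delta> Z\<close> lie in \<open>k + k Y + k Z\<close>, they generate a left coideal
  subalgebra. The monomials \<open>Y\<^sup>b Z\<^sup>c X\<^sup>a\<close> form a basis of \<open>H\<close>. Three operators on a vector space that satisfy
  the relations make it an \<open>H\<close>-module; applied to \<open>H\<close>, to \<open>H \<otimes> H\<close> and to right multiplications, this yields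
  the associative product, the comultiplication and the antipode. Filtering by \<open>deg X = deg Y = 1\<close>,
  \<open>deg Z = 2\<close> gives connectedness and the growth of \<open>H\<close>.
\<close>

section \<open>Linear algebra on finitely supported functions\<close>

text \<open>The constants fit together as follows. With X tensor Y in Delta Z, the commutator of
  Delta Z and Delta Y has the cross term [X, Y] tensor Y, whereas Delta (Y^2 / 2) has Y tensor Y;
  hence [X, Y] = Y goes with the factor 1/2. Likewise [X, Z] = Z, because X tensor Y is an
  eigenvector of ad (Delta X) with eigenvalue 1. With X written last, the coideal subalgebra is the
  span of the monomials without X.

  Two obstacles shape the proof. Independence of ordered monomials usually takes a rewriting
  argument; here the free space on exponent triples is given three operators, the relations are
  verified for them, and the product is read off from this regular module. Multiplicative identities
  then follow by induction on left multiplication by a generator. Secondly, tensors are cosets of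
  formal sums, and maps out of them use a chosen representative. This is settled once:
  \<open>tensor_null\<close> is the kernel of an evaluation map, so a tensor is a finitely supported
  function on pairs of indices, and each axiom becomes an identity between such functions.\<close>

definition scl :: "'k::field \<Rightarrow> ('i \<Rightarrow>\<^sub>0 'k) \<Rightarrow> ('i \<Rightarrow>\<^sub>0 'k)" (infixr "\<bullet>" 75)
  where "c \<bullet> p = Poly_Mapping.map ((*) c) p"

abbreviation bas :: "'i \<Rightarrow> ('i \<Rightarrow>\<^sub>0 'k::field)"
  where "bas i \<equiv> Poly_Mapping.single i 1"

lemma lookup_scl [simp]: "Poly_Mapping.lookup (c \<bullet> p) i = c * Poly_Mapping.lookup p i"
  by (simp add: scl_def Poly_Mapping.map.rep_eq when_def)

lemma scl_add_right: "c \<bullet> (p + q) = c \<bullet> p + c \<bullet> q"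
  and scl_add_left: "(c + d) \<bullet> p = c \<bullet> p + d \<bullet> p"
  and scl_diff_right: "c \<bullet> (p - q) = c \<bullet> p - c \<bullet> q"
  and scl_scl [simp]: "c \<bullet> d \<bullet> p = (c * d) \<bullet> p"
  and scl_one [simp]: "1 \<bullet> p = p"
  and scl_zero_left [simp]: "0 \<bullet> p = 0"
  and scl_zero_right [simp]: "c \<bullet> 0 = 0"
  and scl_minus_left: "(- c) \<bullet> p = - (c \<bullet> p)"
  and scl_minus_right [simp]: "c \<bullet> (- p) = - (c \<bullet> p)"
  and scl_single: "c \<bullet> Poly_Mapping.single i d = Poly_Mapping.single i (c * d)"
  for c d :: "'k::field"
  by (auto intro!: poly_mapping_eqI simp: lookup_add lookup_minus lookup_single when_def algebra_simps)

lemma scl_sum_right: "c \<bullet> (\<Sum>x\<in>A. f x) = (\<Sum>x\<in>A. c \<bullet> f x)"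
  by (induction A rule: infinite_finite_induct) (simp_all add: scl_add_right)

lemma keys_scl: "Poly_Mapping.keys (c \<bullet> p) \<subseteq> Poly_Mapping.keys p"
  by (auto simp: in_keys_iff)

interpretation pm: vector_space "scl :: 'k::field \<Rightarrow> ('i \<Rightarrow>\<^sub>0 'k) \<Rightarrow> _"
  by unfold_locales (simp_all add: scl_add_right scl_add_left)

section \<open>Linear maps and linear extension from a basis\<close>

definition lin :: "(('i \<Rightarrow>\<^sub>0 'k::field) \<Rightarrow> ('j \<Rightarrow>\<^sub>0 'k)) \<Rightarrow> bool" where
  "lin f \<longleftrightarrow> (\<forall>x y. f (x + y) = f x + f y) \<and> (\<forall>c x. f (c \<bullet> x) = c \<bullet> f x)"

lemma linI: "(\<And>x y. f (x + y) = f x + f y) \<Longrightarrow> (\<And>c x. f (c \<bullet> x) = c \<bullet> f x) \<Longrightarrow> lin f"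
  by (simp add: lin_def)

lemma lin_add: "lin f \<Longrightarrow> f (x + y) = f x + f y"
  and lin_scl: "lin f \<Longrightarrow> f (c \<bullet> x) = c \<bullet> f x"
  by (simp_all add: lin_def)

lemma lin_zero: "lin f \<Longrightarrow> f 0 = 0"
  using lin_scl[of f 0 0] by simp

lemma lin_minus: "lin f \<Longrightarrow> f (- x) = - f x"
  using lin_scl[of f "-1" x] by (simp add: scl_minus_left)

lemma lin_diff: "lin f \<Longrightarrow> f (x - y) = f x - f y"
  using lin_add[of f x "- y"] by (simp add: lin_minus[of f])

lemma lin_sum: "lin f \<Longrightarrow> f (\<Sum>x\<in>A. g x) = (\<Sum>x\<in>A. f (g x))"
  by (induction A rule: infinite_finite_induct) (simp_all add: lin_add[of f] lin_zero[of f])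

lemmas lin_simps = lin_add lin_scl lin_zero lin_minus lin_diff

lemma lin_id [intro, simp]: "lin (\<lambda>x. x)"
  and lin_const_zero [intro, simp]: "lin (\<lambda>x. 0)"
  by (simp_all add: lin_def)

lemma lin_compose: "lin f \<Longrightarrow> lin g \<Longrightarrow> lin (\<lambda>x. f (g x))"
  and lin_plus: "lin g \<Longrightarrow> lin h \<Longrightarrow> lin (\<lambda>x. g x + h x)"
  by (simp_all add: lin_def scl_add_right mult.commute)

lemma lin_funpow: "lin f \<Longrightarrow> lin (f ^^ n)" for f :: "('i \<Rightarrow>\<^sub>0 'k::field) \<Rightarrow> ('i \<Rightarrow>\<^sub>0 'k)"
  by (induction n) (simp_all add: lin_def)

definition lext :: "('i \<Rightarrow> ('j \<Rightarrow>\<^sub>0 'k::field)) \<Rightarrow> ('i \<Rightarrow>\<^sub>0 'k) \<Rightarrow> ('j \<Rightarrow>\<^sub>0 'k)" where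
  "lext F p = (\<Sum>i\<in>Poly_Mapping.keys p. Poly_Mapping.lookup p i \<bullet> F i)"

lemma lext_superset:
  assumes "finite A" "Poly_Mapping.keys p \<subseteq> A"
  shows "lext F p = (\<Sum>i\<in>A. Poly_Mapping.lookup p i \<bullet> F i)"
  unfolding lext_def using assms
  by (intro sum.mono_neutral_left) (auto simp: in_keys_iff)

lemma lin_lext [intro, simp]: "lin (lext F)" for F :: "'i \<Rightarrow> ('j \<Rightarrow>\<^sub>0 'k::field)"
proof (rule linI)
  fix p q :: "'i \<Rightarrow>\<^sub>0 'k"
  let ?A = "Poly_Mapping.keys p \<union> Poly_Mapping.keys q"
  have "lext F (p + q) = (\<Sum>i\<in>?A. Poly_Mapping.lookup (p + q) i \<bullet> F i)"
    using keys_add[of p q] by (intro lext_superset) auto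
  also have "\<dots> = (\<Sum>i\<in>?A. Poly_Mapping.lookup p i \<bullet> F i) + (\<Sum>i\<in>?A. Poly_Mapping.lookup q i \<bullet> F i)"
    by (simp add: lookup_add scl_add_left sum.distrib)
  also have "\<dots> = lext F p + lext F q"
    by (intro arg_cong2[of _ _ _ _ "(+)"]; subst lext_superset[of ?A]) auto
  finally show "lext F (p + q) = lext F p + lext F q" .
next
  fix c and p :: "'i \<Rightarrow>\<^sub>0 'k"
  show "lext F (c \<bullet> p) = c \<bullet> lext F p"
    by (subst lext_superset[of "Poly_Mapping.keys p"])
      (auto simp: keys_scl lext_def scl_sum_right)
qed

lemma lext_single: "lext F (Poly_Mapping.single i c) = c \<bullet> F i"
  by (simp add: lext_superset[of "{i}"])

lemma lext_bas [simp]: "lext F (bas i) = F i"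
  by (simp add: lext_single)

lemma lext_of_bas: "lext bas p = p"
proof (rule poly_mapping_eqI)
  fix i
  have "Poly_Mapping.lookup (lext bas p) i =
      (\<Sum>j\<in>Poly_Mapping.keys p. if i = j then Poly_Mapping.lookup p j else 0)"
    unfolding lext_def lookup_sum
    by (intro sum.cong) (auto simp: lookup_single when_def)
  then show "Poly_Mapping.lookup (lext bas p) i = Poly_Mapping.lookup p i"
    by (auto simp: in_keys_iff)
qed

lemma lin_lext_commute: "lin f \<Longrightarrow> f (lext F p) = lext (\<lambda>i. f (F i)) p"
  by (simp add: lext_def lin_sum[of f] lin_scl[of f])

lemma lin_eq_lext: "lin f \<Longrightarrow> f p = lext (\<lambda>i. f (bas i)) p"
  using lin_lext_commute[of f bas p] by (simp add: lext_of_bas)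

lemma lin_eqI:
  assumes "lin f" "lin g" "\<And>i. f (bas i) = g (bas i)"
  shows "f p = g p"
  using lin_eq_lext[OF assms(1), of p] lin_eq_lext[OF assms(2), of p] assms(3) by simp

lemma poly_mapping_linear_induct [case_names basis add scale]:
  assumes "\<And>i. P (bas i)" "\<And>p q. P p \<Longrightarrow> P q \<Longrightarrow> P (p + q)" "\<And>c p. P p \<Longrightarrow> P (c \<bullet> p)"
  shows "P (p :: 'i \<Rightarrow>\<^sub>0 'k::field)"
proof -
  \<comment> \<open>Any index serves: 0 is the zero multiple of every basis vector.\<close>
  have zero: "P 0"
    using assms(3)[OF assms(1), of 0 undefined] by simp
  have "P (\<Sum>i\<in>A. Poly_Mapping.lookup p i \<bullet> bas i)" for A
  proof (induction A rule: infinite_finite_induct)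
    case (insert i A)
    then show ?case
      using assms(2)[OF assms(3)[OF assms(1)]] by simp
  qed (simp_all add: zero)
  then show ?thesis
    using lext_of_bas[of p] unfolding lext_def by metis
qed

lemma lin_lext_param: "(\<And>i. lin (\<lambda>x. F x i)) \<Longrightarrow> lin (\<lambda>x. lext (F x) p)"
  by (simp add: lin_def lext_def scl_add_right sum.distrib scl_sum_right mult.commute)

section \<open>Bilinear maps and tensor products of free vector spaces\<close>

definition bilin :: "(('i \<Rightarrow>\<^sub>0 'k::field) \<Rightarrow> ('j \<Rightarrow>\<^sub>0 'k) \<Rightarrow> ('l \<Rightarrow>\<^sub>0 'k)) \<Rightarrow> bool" where
  "bilin b \<longleftrightarrow> (\<forall>y. lin (\<lambda>x. b x y)) \<and> (\<forall>x. lin (\<lambda>y. b x y))"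

lemma bilinI: "(\<And>y. lin (\<lambda>x. b x y)) \<Longrightarrow> (\<And>x. lin (\<lambda>y. b x y)) \<Longrightarrow> bilin b"
  by (simp add: bilin_def)

lemma bilin_left: "bilin b \<Longrightarrow> lin (\<lambda>x. b x y)"
  and bilin_right: "bilin b \<Longrightarrow> lin (\<lambda>y. b x y)"
  by (simp_all add: bilin_def)

lemma bilin_eqI:
  assumes "bilin f" "bilin g" "\<And>i j. f (bas i) (bas j) = g (bas i) (bas j)"
  shows "f x y = g x y"
proof -
  have "f (bas i) y = g (bas i) y" for i
    by (rule lin_eqI[of "f (bas i)" "g (bas i)"]) (use assms in \<open>auto simp: bilin_def\<close>)
  moreover have "lin (\<lambda>x. f x y)" "lin (\<lambda>x. g x y)"
    using assms by (simp_all add: bilin_def)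
  ultimately show ?thesis
    using lin_eqI[of "\<lambda>x. f x y" "\<lambda>x. g x y" x] by blast
qed

text \<open>The free space on pairs serves as the tensor product of two free spaces; this is the
  elementary tensor in it.\<close>

definition tens :: "('i \<Rightarrow>\<^sub>0 'k::field) \<Rightarrow> ('j \<Rightarrow>\<^sub>0 'k) \<Rightarrow> ('i \<times> 'j \<Rightarrow>\<^sub>0 'k)" (infixr "\<star>" 73) where
  "x \<star> y = lext (\<lambda>i. lext (\<lambda>j. bas (i, j)) y) x"

lemma bilin_tens: "bilin (\<star>)"
  unfolding tens_def by (intro bilinI lin_lext lin_lext_param)

lemma tens_bas [simp]: "bas i \<star> bas j = bas (i, j)"
  by (simp add: tens_def)

lemma lin_tens_left: "lin f \<Longrightarrow> lin (\<lambda>x. f x \<star> y)"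
  and lin_tens_right: "lin f \<Longrightarrow> lin (\<lambda>x. y \<star> f x)"
  using lin_compose[OF bilin_left[OF bilin_tens]] lin_compose[OF bilin_right[OF bilin_tens]] by auto

lemma bilin_lin_tens: "lin f \<Longrightarrow> bilin (\<lambda>x y. f (x \<star> y))"
  by (intro bilinI lin_compose[OF _ bilin_left[OF bilin_tens]]
      lin_compose[OF _ bilin_right[OF bilin_tens]])

lemmas tens_simps =
  lin_simps[OF bilin_left[OF bilin_tens]] lin_simps[OF bilin_right[OF bilin_tens]]

text \<open>The linear map that the universal property attaches to \<open>b\<close>. It reads
  \<open>b\<close> at basis vectors alone, hence the bilinearity hypothesis in
  \<open>blift_tens\<close>.\<close>

definition blift ::
  "(('i \<Rightarrow>\<^sub>0 'k::field) \<Rightarrow> ('j \<Rightarrow>\<^sub>0 'k) \<Rightarrow> ('l \<Rightarrow>\<^sub>0 'k)) \<Rightarrow> ('i \<times> 'j \<Rightarrow>\<^sub>0 'k) \<Rightarrow> ('l \<Rightarrow>\<^sub>0 'k)" where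
  "blift b = lext (\<lambda>(i, j). b (bas i) (bas j))"

lemma lin_blift [intro, simp]: "lin (blift b)"
  by (simp add: blift_def)

lemma blift_tens: "bilin b \<Longrightarrow> blift b (x \<star> y) = b x y"
  by (rule bilin_eqI[OF bilin_lin_tens[OF lin_blift]]) (simp_all add: blift_def)

lemma tens_eqI:
  assumes "lin f" "lin g" "\<And>x y. f (x \<star> y) = g (x \<star> y)"
  shows "f w = g w"
proof (rule lin_eqI[OF assms(1,2)])
  fix i :: "'a \<times> 'b"
  show "f (bas i) = g (bas i)"
    using assms(3)[of "bas (fst i)" "bas (snd i)"] by simp
qed

definition tmap ::
  "(('i \<Rightarrow>\<^sub>0 'k::field) \<Rightarrow> ('m \<Rightarrow>\<^sub>0 'k)) \<Rightarrow> (('j \<Rightarrow>\<^sub>0 'k) \<Rightarrow> ('n \<Rightarrow>\<^sub>0 'k)) \<Rightarrow>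
   ('i \<times> 'j \<Rightarrow>\<^sub>0 'k) \<Rightarrow> ('m \<times> 'n \<Rightarrow>\<^sub>0 'k)" where
  "tmap f g = blift (\<lambda>x y. f x \<star> g y)"

lemma lin_tmap [intro, simp]: "lin (tmap f g)"
  by (simp add: tmap_def)

lemma tmap_tens: "lin f \<Longrightarrow> lin g \<Longrightarrow> tmap f g (x \<star> y) = f x \<star> g y"
  unfolding tmap_def by (intro blift_tens bilinI lin_tens_left lin_tens_right)

section \<open>The enveloping algebra in coordinates\<close>

text \<open>
  The index \<open>(b, c, a)\<close> stands for the monomial \<open>Y\<^sup>b Z\<^sup>c X\<^sup>a\<close>; the following are the left
  multiplications by the generators, read off from \<open>[X, Y] = Y\<close>, \<open>[X, Z] = Z\<close> and \<open>[Z, Y] = Y\<^sup>2 / 2\<close>.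
\<close>

type_synonym 'k pbw = "nat \<times> nat \<times> nat \<Rightarrow>\<^sub>0 'k"

definition LX :: "'k::field_char_0 pbw \<Rightarrow> 'k pbw" where
  "LX = lext (\<lambda>(b, c, a). bas (b, c, Suc a) + of_nat (b + c) \<bullet> bas (b, c, a))"

definition LY :: "'k::field_char_0 pbw \<Rightarrow> 'k pbw" where
  "LY = lext (\<lambda>(b, c, a). bas (Suc b, c, a))"

definition LZ :: "'k::field_char_0 pbw \<Rightarrow> 'k pbw" where
  "LZ = lext (\<lambda>(b, c, a). bas (b, Suc c, a) + (of_nat b / 2) \<bullet> bas (Suc b, c, a))"

text \<open>The coefficients come from derivations: ad X multiplies Y^b Z^c by b + c, and ad Z sends
  Y^b to (b / 2) Y^(b+1).\<close>

lemma LX_bas: "LX (bas (b, c, a)) = bas (b, c, Suc a) + of_nat (b + c) \<bullet> bas (b, c, a)"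
  and LY_bas: "LY (bas (b, c, a)) = bas (Suc b, c, a)"
  and LZ_bas: "LZ (bas (b, c, a)) = bas (b, Suc c, a) + (of_nat b / 2) \<bullet> bas (Suc b, c, a)"
  by (simp_all add: LX_def LY_def LZ_def)

lemma lin_L [intro, simp]: "lin LX" "lin LY" "lin LZ"
  by (simp_all add: LX_def LY_def LZ_def)

lemmas L_simps [simp] = lin_L[THEN lin_add] lin_L[THEN lin_scl] lin_L[THEN lin_zero]
  lin_L[THEN lin_minus] lin_L[THEN lin_diff]

definition pbw_one :: "'k::field_char_0 pbw" where
  "pbw_one = bas (0, 0, 0)"

lemma bas_eq_L: "bas (b, c, a) = (LY ^^ b) ((LZ ^^ c) ((LX ^^ a) pbw_one))"
proof -
  have X: "(LX ^^ a) pbw_one = bas (0, 0, a)"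
    by (induction a) (simp_all add: pbw_one_def LX_bas)
  have Z: "(LZ ^^ c) (bas (0, 0, a)) = bas (0, c, a)"
    by (induction c) (simp_all add: LZ_bas)
  have Y: "(LY ^^ b) (bas (0, c, a)) = bas (b, c, a)"
    by (induction b) (simp_all add: LY_bas)
  show ?thesis by (simp add: X Y Z)
qed

text \<open>Every monomial arises from 1 by left multiplications, X applied first and Y last
  (\<open>bas_eq_L\<close>). This is the induction principle behind associativity and most Hopf
  axioms.\<close>

lemma pbw_induct [case_names one add scale X Y Z]:
  assumes "P pbw_one" and "\<And>p q. P p \<Longrightarrow> P q \<Longrightarrow> P (p + q)" and "\<And>c p. P p \<Longrightarrow> P (c \<bullet> p)"
    and "\<And>p. P p \<Longrightarrow> P (LX p)" "\<And>p. P p \<Longrightarrow> P (LY p)" "\<And>p. P p \<Longrightarrow> P (LZ p)"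
  shows "P p"
proof (induction p rule: poly_mapping_linear_induct)
  case (basis i)
  obtain b c a where i: "i = (b, c, a)" by (metis prod_cases3)
  have "P ((LX ^^ a) pbw_one)" by (induction a) (simp_all add: assms(1,4))
  then have "P ((LZ ^^ c) ((LX ^^ a) pbw_one))" by (induction c) (simp_all add: assms(6))
  then have "P ((LY ^^ b) ((LZ ^^ c) ((LX ^^ a) pbw_one)))" by (induction b) (simp_all add: assms(5))
  then show ?case by (simp add: i bas_eq_L)
qed (use assms in auto)

lemma pbw_eqI:
  assumes "lin f" "lin g" "f pbw_one = g pbw_one"
    and "\<And>p. f p = g p \<Longrightarrow> f (LX p) = g (LX p)"
    and "\<And>p. f p = g p \<Longrightarrow> f (LY p) = g (LY p)"
    and "\<And>p. f p = g p \<Longrightarrow> f (LZ p) = g (LZ p)"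
  shows "f p = g p"
  by (induction p rule: pbw_induct)
    (use assms(3-) in \<open>simp_all add: lin_add[OF assms(1)] lin_add[OF assms(2)]
      lin_scl[OF assms(1)] lin_scl[OF assms(2)]\<close>)

section \<open>Modules over the enveloping algebra, given by three operators\<close>

locale pbw_action =
  fixes fx fy fz :: "('j \<Rightarrow>\<^sub>0 'k::field_char_0) \<Rightarrow> ('j \<Rightarrow>\<^sub>0 'k)"
  assumes lin_f [intro, simp]: "lin fx" "lin fy" "lin fz"
    and fx_fy: "fx (fy w) = fy (fx w) + fy w"
    and fx_fz: "fx (fz w) = fz (fx w) + fz w"
    and fz_fy: "fz (fy w) = fy (fz w) + (1 / 2) \<bullet> fy (fy w)"
begin

definition act :: "'k pbw \<Rightarrow> ('j \<Rightarrow>\<^sub>0 'k) \<Rightarrow> ('j \<Rightarrow>\<^sub>0 'k)" where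
  "act p w = lext (\<lambda>(b, c, a). (fy ^^ b) ((fz ^^ c) ((fx ^^ a) w))) p"

lemmas f_simps [simp] = lin_f[THEN lin_add] lin_f[THEN lin_scl]

lemma lin_act: "lin (\<lambda>p. act p w)"
  by (simp add: act_def)

lemmas act_simps = lin_simps[OF lin_act]

lemma act_bas: "act (bas (b, c, a)) w = (fy ^^ b) ((fz ^^ c) ((fx ^^ a) w))"
  by (simp add: act_def)

lemma act_one [simp]: "act pbw_one w = w"
  by (simp add: pbw_one_def act_bas)

lemma lin_act_right: "lin (act p)"
  unfolding act_def
  by (rule lin_lext_param)
    (auto split: prod.split
      intro: lin_compose[OF lin_funpow lin_compose[OF lin_funpow lin_funpow]])

lemma fx_fy_pow: "fx ((fy ^^ n) w) = (fy ^^ n) (fx w) + of_nat n \<bullet> (fy ^^ n) w"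
  by (induction n) (simp_all add: fx_fy scl_add_left add_ac)

lemma fx_fz_pow: "fx ((fz ^^ n) w) = (fz ^^ n) (fx w) + of_nat n \<bullet> (fz ^^ n) w"
  by (induction n) (simp_all add: fx_fz scl_add_left add_ac)

lemma fz_fy_pow: "fz ((fy ^^ n) w) = (fy ^^ n) (fz w) + (of_nat n / 2) \<bullet> (fy ^^ Suc n) w"
  by (induction n) (simp_all add: fz_fy scl_add_left add_ac add_divide_distrib)

text \<open>Y already stands leftmost in a monomial, so this case is immediate. In the two lemmas
  below, Z has to pass Y^b and X has to pass both powers, which is the purpose of the commutation
  rules above.\<close>

lemma act_LY: "act (LY p) w = fy (act p w)"
proof (rule lin_eqI[OF lin_compose[OF lin_act] lin_compose[OF _ lin_act]])
  fix i :: "nat \<times> nat \<times> nat"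
  show "act (LY (bas i)) w = fy (act (bas i) w)"
    by (cases i) (simp add: LY_bas act_bas)
qed auto

lemma act_LZ: "act (LZ p) w = fz (act p w)"
proof (rule lin_eqI[OF lin_compose[OF lin_act] lin_compose[OF _ lin_act]])
  fix i :: "nat \<times> nat \<times> nat"
  show "act (LZ (bas i)) w = fz (act (bas i) w)"
    by (cases i) (simp add: LZ_bas act_simps act_bas fz_fy_pow)
qed auto

lemma act_LX: "act (LX p) w = fx (act p w)"
proof (rule lin_eqI[OF lin_compose[OF lin_act] lin_compose[OF _ lin_act]])
  fix i :: "nat \<times> nat \<times> nat"
  obtain b c a where i: "i = (b, c, a)" by (metis prod_cases3)
  note lin = lin_funpow[OF lin_f(2)]
  show "act (LX (bas i)) w = fx (act (bas i) w)"
    by (simp add: i LX_bas act_simps act_bas fx_fy_pow fx_fz_pow lin_add[OF lin] lin_scl[OF lin]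
        scl_add_left add_ac)
qed auto

end

text \<open>This is the substitute for the Poincare-Birkhoff-Witt theorem: the operators satisfy the
  defining relations on a space in which the ordered monomials are independent by construction. Both
  sides are linear, so basis vectors suffice.\<close>

interpretation L: pbw_action LX LY LZ
proof
  show "LX (LY p) = LY (LX p) + LY p" for p :: "'k::field_char_0 pbw"
  proof (rule lin_eqI[of "\<lambda>p. LX (LY p)" "\<lambda>p. LY (LX p) + LY p"])
    fix i :: "nat \<times> nat \<times> nat"
    obtain b c a where i: "i = (b, c, a)" by (metis prod_cases3)
    show "LX (LY (bas i)) = LY (LX (bas i)) + LY (bas i :: 'k pbw)"
      by (simp add: i LX_bas LY_bas scl_add_left add_ac)
  qed (simp_all add: lin_def scl_add_right add_ac mult_ac)
  show "LX (LZ p) = LZ (LX p) + LZ p" for p :: "'k::field_char_0 pbw"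
  proof (rule lin_eqI[of "\<lambda>p. LX (LZ p)" "\<lambda>p. LZ (LX p) + LZ p"])
    fix i :: "nat \<times> nat \<times> nat"
    obtain b c a where i: "i = (b, c, a)" by (metis prod_cases3)
    show "LX (LZ (bas i)) = LZ (LX (bas i)) + LZ (bas i :: 'k pbw)"
      by (simp add: i LX_bas LZ_bas scl_add_left scl_add_right add_ac algebra_simps)
  qed (simp_all add: lin_def scl_add_right add_ac mult_ac)
  show "LZ (LY p) = LY (LZ p) + (1 / 2) \<bullet> LY (LY p)" for p :: "'k::field_char_0 pbw"
  proof (rule lin_eqI[of "\<lambda>p. LZ (LY p)" "\<lambda>p. LY (LZ p) + (1 / 2) \<bullet> LY (LY p)"])
    fix i :: "nat \<times> nat \<times> nat"
    obtain b c a where i: "i = (b, c, a)" by (metis prod_cases3)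
    show "LZ (LY (bas i)) = LY (LZ (bas i)) + (1 / 2) \<bullet> LY (LY (bas i :: 'k pbw))"
      by (simp add: i LY_bas LZ_bas scl_add_left add_ac add_divide_distrib)
  qed (simp_all add: lin_def scl_add_right add_ac mult_ac)
qed auto

abbreviation pbw_mult :: "'k::field_char_0 pbw \<Rightarrow> 'k pbw \<Rightarrow> 'k pbw" where
  "pbw_mult \<equiv> L.act"

lemmas L_rels = L.fx_fy L.fx_fz L.fz_fy

lemmas mult_L [simp] = L.act_LX L.act_LY L.act_LZ

lemma bilin_mult: "bilin pbw_mult"
  by (intro bilinI L.lin_act L.lin_act_right)

lemmas mult_simps [simp] =
  lin_simps[OF bilin_left[OF bilin_mult]] lin_simps[OF bilin_right[OF bilin_mult]]

lemma mult_one_right [simp]: "pbw_mult p pbw_one = p"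
  by (rule pbw_eqI[OF L.lin_act lin_id]) auto

text \<open>As functions of p, both sides agree at 1 and commute with the left multiplications by
  the generators.\<close>

lemma mult_assoc: "pbw_mult (pbw_mult p q) r = pbw_mult p (pbw_mult q r)"
  by (induction p rule: pbw_induct) simp_all

subsection \<open>Comultiplication and counit\<close>

text \<open>Left multiplication by the intended Delta X, and likewise below for Y and Z, written as
  operators because no product on H tensor H is available yet.\<close>

definition DX :: "(_ \<Rightarrow>\<^sub>0 'k::field_char_0) \<Rightarrow> _" where "DX u = tmap LX (\<lambda>x. x) u + tmap (\<lambda>x. x) LX u"
definition DY :: "(_ \<Rightarrow>\<^sub>0 'k::field_char_0) \<Rightarrow> _" where "DY u = tmap LY (\<lambda>x. x) u + tmap (\<lambda>x. x) LY u"
definition DZ :: "(_ \<Rightarrow>\<^sub>0 'k::field_char_0) \<Rightarrow> _" where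
  "DZ u = tmap LZ (\<lambda>x. x) u + tmap (\<lambda>x. x) LZ u + tmap LX LY u"

lemma lin_D [intro, simp]: "lin DX" "lin DY" "lin DZ"
  unfolding DX_def[abs_def] DY_def[abs_def] DZ_def[abs_def] by (intro lin_plus lin_tmap)+

lemma D_tens [simp]:
  "DX (x \<star> y) = LX x \<star> y + x \<star> LX y"
  "DY (x \<star> y) = LY x \<star> y + x \<star> LY y"
  "DZ (x \<star> y) = LZ x \<star> y + x \<star> LZ y + LX x \<star> LY y"
  by (simp_all add: DX_def DY_def DZ_def tmap_tens)

lemmas D_simps [simp] = lin_D[THEN lin_add] lin_D[THEN lin_scl] lin_D[THEN lin_minus]
  lin_D[THEN lin_zero]

interpretation D: pbw_action DX DY DZ
proof
  show "DX (DY u) = DY (DX u) + DY u" for u :: "_ \<Rightarrow>\<^sub>0 'k::field_char_0"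
    by (rule tens_eqI[of "\<lambda>u. DX (DY u)" "\<lambda>u. DY (DX u) + DY u"])
      (simp_all add: L_rels tens_simps lin_def scl_add_right add_ac)
  show "DX (DZ u) = DZ (DX u) + DZ u" for u :: "_ \<Rightarrow>\<^sub>0 'k::field_char_0"
    by (rule tens_eqI[of "\<lambda>u. DX (DZ u)" "\<lambda>u. DZ (DX u) + DZ u"])
      (simp_all add: L_rels tens_simps lin_def scl_add_right add_ac)
  show "DZ (DY u) = DY (DZ u) + (1 / 2) \<bullet> DY (DY u)" for u :: "_ \<Rightarrow>\<^sub>0 'k::field_char_0"
  proof (rule tens_eqI[of "\<lambda>u. DZ (DY u)" "\<lambda>u. DY (DZ u) + (1 / 2) \<bullet> DY (DY u)"])
    fix x y :: "'k pbw"
    \<comment> \<open>The origin of the 1/2: X tensor Y passing Y tensor 1 leaves one Y tensor Y,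
      which has to match the two cross terms in half the square of Y tensor 1 + 1 tensor Y.\<close>
    have "v = (1 / 2) \<bullet> v + (1 / 2) \<bullet> v" for v :: "'j \<Rightarrow>\<^sub>0 'k"
      by (simp flip: scl_add_left)
    from this[of "LY x \<star> LY y"]
    show "DZ (DY (x \<star> y)) = DY (DZ (x \<star> y)) + (1 / 2) \<bullet> DY (DY (x \<star> y))"
      by (simp add: L_rels tens_simps scl_add_right add_ac)
  qed (simp_all add: lin_def scl_add_right add_ac mult_ac)
qed auto

definition comult :: "'k::field_char_0 pbw \<Rightarrow> (_ \<Rightarrow>\<^sub>0 'k)" where
  "comult p = D.act p (pbw_one \<star> pbw_one)"

lemma lin_comult [intro, simp]: "lin comult"
  unfolding comult_def[abs_def] by (rule D.lin_act)

lemmas comult_simps [simp] = lin_simps[OF lin_comult]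

lemma comult_one [simp]: "comult pbw_one = pbw_one \<star> pbw_one"
  and comult_L [simp]: "comult (LX p) = DX (comult p)" "comult (LY p) = DY (comult p)"
    "comult (LZ p) = DZ (comult p)"
  by (simp_all add: comult_def D.act_LX D.act_LY D.act_LZ)

definition tens_mult :: "(_ \<Rightarrow>\<^sub>0 'k::field_char_0) \<Rightarrow> (_ \<Rightarrow>\<^sub>0 'k) \<Rightarrow> (_ \<Rightarrow>\<^sub>0 'k)" where
  "tens_mult u v = blift (\<lambda>x y. tmap (pbw_mult x) (pbw_mult y) v) u"

lemma bilin_tmap_mult: "bilin (\<lambda>x y. tmap (pbw_mult x) (pbw_mult y) v)"
proof (rule bilinI)
  show "lin (\<lambda>x. tmap (pbw_mult x) (pbw_mult y) v)" for y
    unfolding tmap_def blift_def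
    by (rule lin_lext_param) (auto intro!: lin_tens_left lin_tens_right L.lin_act split: prod.split)
  show "lin (\<lambda>y. tmap (pbw_mult x) (pbw_mult y) v)" for x
    unfolding tmap_def blift_def
    by (rule lin_lext_param) (auto intro!: lin_tens_left lin_tens_right L.lin_act split: prod.split)
qed

lemma tens_mult_tens_left: "tens_mult (x \<star> y) v = tmap (pbw_mult x) (pbw_mult y) v"
  by (simp add: tens_mult_def blift_tens bilin_tmap_mult)

lemma tens_mult_tens [simp]: "tens_mult (x \<star> y) (x' \<star> y') = pbw_mult x x' \<star> pbw_mult y y'"
  by (simp add: tens_mult_tens_left tmap_tens L.lin_act_right)

lemma bilin_tens_mult: "bilin tens_mult"
proof (rule bilinI)
  show "lin (\<lambda>u. tens_mult u v)" for v :: "_ \<Rightarrow>\<^sub>0 'k::field_char_0"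
    by (simp add: tens_mult_def)
  show "lin (tens_mult u)" for u :: "_ \<Rightarrow>\<^sub>0 'k::field_char_0"
    unfolding tens_mult_def blift_def
    by (rule lin_lext_param) (auto split: prod.split)
qed

lemmas tens_mult_simps [simp] =
  lin_simps[OF bilin_left[OF bilin_tens_mult]] lin_simps[OF bilin_right[OF bilin_tens_mult]]

lemma tens_mult_one [simp]: "tens_mult (pbw_one \<star> pbw_one) v = v"
  by (rule tens_eqI[OF bilin_right[OF bilin_tens_mult] lin_id]) auto

lemma bilin_compose_left: "bilin b \<Longrightarrow> lin f \<Longrightarrow> bilin (\<lambda>u v. b (f u) v)"
  and bilin_compose_outer: "bilin b \<Longrightarrow> lin f \<Longrightarrow> bilin (\<lambda>u v. f (b u v))"
  by (simp_all add: bilin_def lin_def)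

lemma tens_bilin_eqI:
  fixes f g :: "('i \<times> 'j \<Rightarrow>\<^sub>0 'k::field) \<Rightarrow> ('l \<times> 'm \<Rightarrow>\<^sub>0 'k) \<Rightarrow> ('n \<Rightarrow>\<^sub>0 'k)"
  assumes "bilin f" "bilin g" "\<And>x y x' y'. f (x \<star> y) (x' \<star> y') = g (x \<star> y) (x' \<star> y')"
  shows "f u v = g u v"
proof (rule bilin_eqI[OF assms(1,2)])
  fix i :: "'i \<times> 'j" and j :: "'l \<times> 'm"
  show "f (bas i) (bas j) = g (bas i) (bas j)"
    using assms(3)[of "bas (fst i)" "bas (snd i)" "bas (fst j)" "bas (snd j)"] by simp
qed

text \<open>The three operators are left multiplications, so they commute with right multiplication
  by \<open>v\<close>. This is the inductive step of \<open>comult_mult\<close>.\<close>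

lemma tens_mult_D [simp]:
  "tens_mult (DX u) v = DX (tens_mult u v)"
  "tens_mult (DY u) v = DY (tens_mult u v)"
  "tens_mult (DZ u) v = DZ (tens_mult u v)"
  by (rule tens_bilin_eqI[OF bilin_compose_left bilin_compose_outer];
      simp add: bilin_tens_mult)+

lemma comult_mult: "comult (pbw_mult p q) = tens_mult (comult p) (comult q)"
  by (induction p rule: pbw_induct) simp_all

definition counit :: "'k::field_char_0 pbw \<Rightarrow> 'k" where
  "counit p = Poly_Mapping.lookup p (0, 0, 0)"

lemma counit_simps [simp]:
  "counit (p + q) = counit p + counit q" "counit (c \<bullet> p) = c * counit p"
  "counit pbw_one = 1"
  by (simp_all add: counit_def lookup_add pbw_one_def)

text \<open>The only term that could hit the monomial 1 is (b + c) \<open>bas (b, c, a)\<close> in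
  \<open>LX\<close>, and its coefficient vanishes when b = c = 0.\<close>

lemma counit_L [simp]: "counit (LX p) = 0" "counit (LY p) = 0" "counit (LZ p) = 0"
proof -
  have bas: "counit (f (bas i)) = 0" if "f \<in> {LX, LY, LZ}" for f and i
    using that by (cases i) (auto simp: LX_bas LY_bas LZ_bas counit_def lookup_add lookup_single)
  have "counit (f p) = 0" if f: "f \<in> {LX, LY, LZ}" for f
  proof -
    have "lin f" using f by auto
    then show ?thesis
      by (induction p rule: poly_mapping_linear_induct)
        (use bas[OF f] in \<open>simp_all add: lin_add[of f] lin_scl[of f]\<close>)
  qed
  then show "counit (LX p) = 0" "counit (LY p) = 0" "counit (LZ p) = 0" by auto
qed

lemma counit_mult: "counit (pbw_mult p q) = counit p * counit q"
  by (induction p rule: pbw_induct) (simp_all add: algebra_simps)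

lemma bilin_counit: "bilin (\<lambda>x y. counit x \<bullet> y)" "bilin (\<lambda>x y. counit y \<bullet> x)"
  by (simp_all add: bilin_def lin_def scl_add_left scl_add_right mult.commute)

text \<open>The counit kills every term in which a generator acts on the left factor, X tensor Y
  included. What remains is the same generator acting on the right factor.\<close>

lemma counit_left: "blift (\<lambda>x y. counit x \<bullet> y) (comult p) = p"
  for p :: "'k::field_char_0 pbw"
proof -
  let ?M = "blift (\<lambda>x y. counit x \<bullet> y)"
  have X: "?M (DX u) = LX (?M u)" for u :: "_ \<Rightarrow>\<^sub>0 'k"
    by (rule tens_eqI[OF lin_compose lin_compose])
      (auto simp: blift_tens[OF bilin_counit(1)] lin_simps[OF lin_blift])
  have Y: "?M (DY u) = LY (?M u)" for u :: "_ \<Rightarrow>\<^sub>0 'k"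
    by (rule tens_eqI[OF lin_compose lin_compose])
      (auto simp: blift_tens[OF bilin_counit(1)] lin_simps[OF lin_blift])
  have Z: "?M (DZ u) = LZ (?M u)" for u :: "_ \<Rightarrow>\<^sub>0 'k"
    by (rule tens_eqI[OF lin_compose lin_compose])
      (auto simp: blift_tens[OF bilin_counit(1)] lin_simps[OF lin_blift])
  show ?thesis
    by (rule pbw_eqI[OF lin_compose lin_id])
      (auto simp: X Y Z blift_tens[OF bilin_counit(1)])
qed

lemma counit_right: "blift (\<lambda>x y. counit y \<bullet> x) (comult p) = p"
  for p :: "'k::field_char_0 pbw"
proof -
  let ?M = "blift (\<lambda>x y. counit y \<bullet> x)"
  have X: "?M (DX u) = LX (?M u)" for u :: "_ \<Rightarrow>\<^sub>0 'k"
    by (rule tens_eqI[OF lin_compose lin_compose])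
      (auto simp: blift_tens[OF bilin_counit(2)] lin_simps[OF lin_blift])
  have Y: "?M (DY u) = LY (?M u)" for u :: "_ \<Rightarrow>\<^sub>0 'k"
    by (rule tens_eqI[OF lin_compose lin_compose])
      (auto simp: blift_tens[OF bilin_counit(2)] lin_simps[OF lin_blift])
  have Z: "?M (DZ u) = LZ (?M u)" for u :: "_ \<Rightarrow>\<^sub>0 'k"
    by (rule tens_eqI[OF lin_compose lin_compose])
      (auto simp: blift_tens[OF bilin_counit(2)] lin_simps[OF lin_blift])
  show ?thesis
    by (rule pbw_eqI[OF lin_compose lin_id])
      (auto simp: X Y Z blift_tens[OF bilin_counit(2)])
qed

section \<open>Coassociativity\<close>

definition assoc_lin :: "((_ \<times> _) \<times> _ \<Rightarrow>\<^sub>0 'k::field) \<Rightarrow> (_ \<Rightarrow>\<^sub>0 'k)" where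
  "assoc_lin = blift (\<lambda>u z. blift (\<lambda>x y. x \<star> (y \<star> z)) u)"

lemma bilin_assoc_inner: "bilin (\<lambda>x y. x \<star> (y \<star> z))"
  by (intro bilinI lin_tens_left lin_tens_right lin_id)

lemma bilin_assoc_outer:
  "bilin (\<lambda>(u :: 'i \<times> 'j \<Rightarrow>\<^sub>0 'k::field) (z :: 'l \<Rightarrow>\<^sub>0 'k). blift (\<lambda>x y. x \<star> (y \<star> z)) u)"
proof (rule bilinI)
  show "lin (\<lambda>z :: 'l \<Rightarrow>\<^sub>0 'k. blift (\<lambda>x y. x \<star> (y \<star> z)) u)" for u :: "'i \<times> 'j \<Rightarrow>\<^sub>0 'k"
    unfolding blift_def
    by (rule lin_lext_param) (auto intro!: lin_tens_right split: prod.split)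
qed auto

lemma assoc_lin_tens: "assoc_lin ((x \<star> y) \<star> z) = x \<star> (y \<star> z)"
  by (simp add: assoc_lin_def blift_tens bilin_assoc_inner bilin_assoc_outer)

lemma lin_assoc [intro, simp]: "lin assoc_lin"
  by (simp add: assoc_lin_def)

lemma tens3_eqI:
  fixes f g :: "(('i \<times> 'j) \<times> 'l \<Rightarrow>\<^sub>0 'k::field) \<Rightarrow> ('n \<Rightarrow>\<^sub>0 'k)"
  assumes "lin f" "lin g" "\<And>x y z. f ((x \<star> y) \<star> z) = g ((x \<star> y) \<star> z)"
  shows "f w = g w"
proof (rule lin_eqI[OF assms(1,2)])
  fix i :: "('i \<times> 'j) \<times> 'l"
  show "f (bas i) = g (bas i)"
    using assms(3)[of "bas (fst (fst i))" "bas (snd (fst i))" "bas (snd i)"] by simp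
qed

text \<open>Both sides intertwine the left multiplications by the generators.\<close>

lemma coassoc:
  "assoc_lin (tmap comult (\<lambda>x. x) (comult p)) = tmap (\<lambda>x. x) comult (comult p)"
  for p :: "'k::field_char_0 pbw"
proof -
  note simps = tmap_tens lin_simps[OF lin_tmap] lin_simps[OF lin_assoc] assoc_lin_tens tens_simps
    lin_def scl_add_right
  have D1: "tmap comult (\<lambda>x. x) (DX u) = tmap DX (\<lambda>x. x) (tmap comult (\<lambda>x. x) u) + tmap (\<lambda>x. x) LX (tmap comult (\<lambda>x. x) u)"
    "tmap comult (\<lambda>x. x) (DY u) = tmap DY (\<lambda>x. x) (tmap comult (\<lambda>x. x) u) + tmap (\<lambda>x. x) LY (tmap comult (\<lambda>x. x) u)"
    "tmap comult (\<lambda>x. x) (DZ u) = tmap DZ (\<lambda>x. x) (tmap comult (\<lambda>x. x) u) + tmap (\<lambda>x. x) LZ (tmap comult (\<lambda>x. x) u)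
      + tmap DX LY (tmap comult (\<lambda>x. x) u)" for u :: "_ \<Rightarrow>\<^sub>0 'k"
    by (rule tens_eqI[of "\<lambda>u. tmap comult (\<lambda>x. x) (f u)" for f];
      simp add: simps add_ac)+
  have D2: "tmap (\<lambda>x. x) comult (DX u) = tmap LX (\<lambda>x. x) (tmap (\<lambda>x. x) comult u) + tmap (\<lambda>x. x) DX (tmap (\<lambda>x. x) comult u)"
    "tmap (\<lambda>x. x) comult (DY u) = tmap LY (\<lambda>x. x) (tmap (\<lambda>x. x) comult u) + tmap (\<lambda>x. x) DY (tmap (\<lambda>x. x) comult u)"
    "tmap (\<lambda>x. x) comult (DZ u) = tmap LZ (\<lambda>x. x) (tmap (\<lambda>x. x) comult u) + tmap (\<lambda>x. x) DZ (tmap (\<lambda>x. x) comult u)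
      + tmap LX DY (tmap (\<lambda>x. x) comult u)" for u :: "_ \<Rightarrow>\<^sub>0 'k"
    by (rule tens_eqI[of "\<lambda>u. tmap (\<lambda>x. x) comult (f u)" for f];
      simp add: simps add_ac)+
  \<comment> \<open>For Z, each bracketing produces the mixed terms X tensor Y tensor 1 + X tensor 1
    tensor Y + 1 tensor X tensor Y; they match because X and Y are primitive.\<close>
  have A: "assoc_lin (tmap DX (\<lambda>x. x) v + tmap (\<lambda>x. x) LX v) = tmap LX (\<lambda>x. x) (assoc_lin v) + tmap (\<lambda>x. x) DX (assoc_lin v)"
    "assoc_lin (tmap DY (\<lambda>x. x) v + tmap (\<lambda>x. x) LY v) = tmap LY (\<lambda>x. x) (assoc_lin v) + tmap (\<lambda>x. x) DY (assoc_lin v)"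
    "assoc_lin (tmap DZ (\<lambda>x. x) v + tmap (\<lambda>x. x) LZ v + tmap DX LY v) =
      tmap LZ (\<lambda>x. x) (assoc_lin v) + tmap (\<lambda>x. x) DZ (assoc_lin v) + tmap LX DY (assoc_lin v)" for v :: "_ \<Rightarrow>\<^sub>0 'k"
    by (rule tens3_eqI[of "\<lambda>v. assoc_lin (f v)" for f];
      simp add: simps add_ac)+
  show ?thesis
    by (rule pbw_eqI[of "\<lambda>p. assoc_lin (tmap comult (\<lambda>x. x) (comult p))"])
      (auto intro!: lin_compose[OF lin_assoc] lin_compose[OF lin_tmap] simp: D1 D2 A tmap_tens assoc_lin_tens)
qed

subsection \<open>Antipode\<close>

text \<open>The antipodes of the generators. For Z the value solves S(Z) + Z + S(X) Y = 0, the
  antipode axiom applied to Delta Z.\<close>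

definition SX :: "'k::field_char_0 pbw" where "SX = - LX pbw_one"
definition SY :: "'k::field_char_0 pbw" where "SY = - LY pbw_one"
definition SZ :: "'k::field_char_0 pbw" where "SZ = - LZ pbw_one + LX (LY pbw_one)"

lemma mult_S [simp]:
  "pbw_mult SX p = - LX p" "pbw_mult SY p = - LY p" "pbw_mult SZ p = - LZ p + LX (LY p)"
  by (simp_all add: SX_def SY_def SZ_def)

text \<open>An antipode reverses products, S(X p) = S(p) S(X), so the generators act by right
  multiplication with their antipodes. By associativity each relation reduces to one identity
  between \<open>SX\<close>, \<open>SY\<close> and \<open>SZ\<close>.\<close>

interpretation S: pbw_action "\<lambda>w. pbw_mult w SX" "\<lambda>w. pbw_mult w SY" "\<lambda>w. pbw_mult w SZ"
proof
  fix w :: "'k::field_char_0 pbw"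
  have half: "(1 / 2) \<bullet> v + (1 / 2) \<bullet> v = v" for v :: "'k pbw"
    by (simp flip: scl_add_left)
  have "pbw_mult SY SX = pbw_mult SX SY + (SY :: 'k pbw)"
    by (simp only: mult_S) (simp add: SX_def SY_def L_rels)
  then show "pbw_mult (pbw_mult w SY) SX = pbw_mult (pbw_mult w SX) SY + pbw_mult w SY"
    by (simp add: mult_assoc del: mult_S)
  have "pbw_mult SZ SX = pbw_mult SX SZ + (SZ :: 'k pbw)"
    by (simp only: mult_S) (simp add: SX_def SZ_def L_rels)
  then show "pbw_mult (pbw_mult w SZ) SX = pbw_mult (pbw_mult w SX) SZ + pbw_mult w SZ"
    by (simp add: mult_assoc del: mult_S)
  \<comment> \<open>Both sides equal Y Z - Y X Y: on the right, Y^2 / 2 from [Z, Y] and the added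
    Y^2 / 2 cancel the Y^2 from X Y^2 = Y X Y + Y^2.\<close>
  have "pbw_mult SY SZ = pbw_mult SZ SY + (1 / 2) \<bullet> pbw_mult SY (SY :: 'k pbw)"
    using half[of "LY (LY pbw_one)"]
    by (simp only: mult_S) (simp add: SY_def SZ_def L_rels algebra_simps)
  then show "pbw_mult (pbw_mult w SY) SZ = pbw_mult (pbw_mult w SZ) SY + (1 / 2) \<bullet> pbw_mult (pbw_mult w SY) SY"
    by (simp add: mult_assoc del: mult_S)
qed (rule L.lin_act)+

definition antipode :: "'k::field_char_0 pbw \<Rightarrow> 'k pbw" where
  "antipode p = S.act p pbw_one"

lemma lin_antipode [intro, simp]: "lin antipode"
  unfolding antipode_def[abs_def] by (rule S.lin_act)

lemma antipode_one [simp]: "antipode pbw_one = pbw_one"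
  and antipode_L [simp]: "antipode (LX p) = pbw_mult (antipode p) SX"
    "antipode (LY p) = pbw_mult (antipode p) SY" "antipode (LZ p) = pbw_mult (antipode p) SZ"
  by (simp_all add: antipode_def S.act_LX S.act_LY S.act_LZ)

lemma bilin_antipode_left: "bilin (\<lambda>x y. pbw_mult (antipode x) y)"
  by (rule bilin_compose_left[OF bilin_mult lin_antipode])

lemma bilin_antipode_right: "bilin (\<lambda>x y. pbw_mult x (antipode y))"
  by (intro bilinI L.lin_act lin_compose[OF L.lin_act_right lin_antipode])

lemma lin_counit_one: "lin (\<lambda>p. counit p \<bullet> pbw_one)"
  by (simp add: lin_def scl_add_left)

text \<open>In S(x) y a generator and its antipode meet in the middle, as in S(x) (S(X) + X) y, and
  cancel for every tensor. So both sides vanish as soon as a generator is applied.\<close>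

lemma antipode_left: "blift (\<lambda>x y. pbw_mult (antipode x) y) (comult p) = counit p \<bullet> pbw_one"
  for p :: "'k::field_char_0 pbw"
proof -
  let ?M = "blift (\<lambda>x y. pbw_mult (antipode x) y)"
  note simps = blift_tens[OF bilin_antipode_left] lin_simps[OF lin_blift] mult_assoc
  have X: "?M (DX u) = 0" for u :: "_ \<Rightarrow>\<^sub>0 'k"
    by (rule tens_eqI[OF lin_compose lin_const_zero]) (auto simp: simps)
  have Y: "?M (DY u) = 0" for u :: "_ \<Rightarrow>\<^sub>0 'k"
    by (rule tens_eqI[OF lin_compose lin_const_zero]) (auto simp: simps)
  have Z: "?M (DZ u) = 0" for u :: "_ \<Rightarrow>\<^sub>0 'k"
    by (rule tens_eqI[OF lin_compose lin_const_zero]) (auto simp: simps)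
  show ?thesis
    by (rule pbw_eqI[OF lin_compose lin_counit_one]) (auto simp: X Y Z simps)
qed

text \<open>Here the generator and its antipode stand at the outer ends and do not cancel for a
  general tensor. The induction hypothesis makes \<open>?M (comult p)\<close> a multiple of 1, where
  the ends meet and cancel.\<close>

lemma antipode_right: "blift (\<lambda>x y. pbw_mult x (antipode y)) (comult p) = counit p \<bullet> pbw_one"
  for p :: "'k::field_char_0 pbw"
proof -
  let ?M = "blift (\<lambda>x y. pbw_mult x (antipode y))"
  note simps = blift_tens[OF bilin_antipode_right] lin_simps[OF lin_blift] mult_assoc
  have X: "?M (DX u) = LX (?M u) + pbw_mult (?M u) SX" for u :: "_ \<Rightarrow>\<^sub>0 'k"
    by (rule tens_eqI[of "\<lambda>u. ?M (DX u)"])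
      (simp_all add: simps lin_def scl_add_right add_ac)
  have Y: "?M (DY u) = LY (?M u) + pbw_mult (?M u) SY" for u :: "_ \<Rightarrow>\<^sub>0 'k"
    by (rule tens_eqI[of "\<lambda>u. ?M (DY u)"])
      (simp_all add: simps lin_def scl_add_right add_ac)
  have Z: "?M (DZ u) = LZ (?M u) + LX (pbw_mult (?M u) SY) + pbw_mult (?M u) SZ" for u :: "_ \<Rightarrow>\<^sub>0 'k"
    by (rule tens_eqI[of "\<lambda>u. ?M (DZ u)"])
      (simp_all add: simps lin_def scl_add_right add_ac)
  show ?thesis
    by (rule pbw_eqI[OF lin_compose lin_counit_one])
      (auto simp: X Y Z simps SX_def SY_def SZ_def)
qed

section \<open>Modules with coordinates and their tensor products\<close>

lemma carrier_base_field [simp]: "carrier base_field = UNIV"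
  and mult_base_field [simp]: "x \<otimes>\<^bsub>base_field\<^esub> y = x * y"
  and add_base_field [simp]: "x \<oplus>\<^bsub>base_field\<^esub> y = x + y"
  and one_base_field [simp]: "\<one>\<^bsub>base_field\<^esub> = 1"
  and zero_base_field [simp]: "\<zero>\<^bsub>base_field\<^esub> = 0"
  by (simp_all add: ring_of_type_algebra_def)

lemma subspace_ofI:
  assumes "module base_field M" "N \<subseteq> carrier M" "\<zero>\<^bsub>M\<^esub> \<in> N"
    and "\<And>x y. x \<in> N \<Longrightarrow> y \<in> N \<Longrightarrow> x \<oplus>\<^bsub>M\<^esub> y \<in> N" "\<And>c x. x \<in> N \<Longrightarrow> c \<odot>\<^bsub>M\<^esub> x \<in> N"
  shows "subspace_of N M"
proof -
  interpret module base_field M by fact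
  have "\<ominus>\<^bsub>M\<^esub> x \<in> N" if "x \<in> N" for x
  proof -
    have "\<ominus>\<^bsub>M\<^esub> x = (\<ominus>\<^bsub>base_field\<^esub> \<one>\<^bsub>base_field\<^esub>) \<odot>\<^bsub>M\<^esub> x"
      using smult_l_minus[of "\<one>\<^bsub>base_field\<^esub>" x] smult_one[of x] that assms(2) by auto
    then show ?thesis using assms(5)[OF that] by simp
  qed
  then show ?thesis using assms by (intro submoduleI) auto
qed

lemma subspace_ofD:
  assumes "subspace_of N M"
  shows "N \<subseteq> carrier M" "\<zero>\<^bsub>M\<^esub> \<in> N"
    "\<And>x y. x \<in> N \<Longrightarrow> y \<in> N \<Longrightarrow> x \<oplus>\<^bsub>M\<^esub> y \<in> N" "\<And>c x. x \<in> N \<Longrightarrow> c \<odot>\<^bsub>M\<^esub> x \<in> N"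
proof -
  interpret submodule N base_field M by fact
  show "N \<subseteq> carrier M" using subset by simp
  show "\<zero>\<^bsub>M\<^esub> \<in> N" using one_closed by simp
  show "\<And>x y. x \<in> N \<Longrightarrow> y \<in> N \<Longrightarrow> x \<oplus>\<^bsub>M\<^esub> y \<in> N" using m_closed by simp
  show "\<And>c x. x \<in> N \<Longrightarrow> c \<odot>\<^bsub>M\<^esub> x \<in> N" using smult_closed by simp
qed

lemma lin_span_incl: "x \<in> S \<Longrightarrow> x \<in> lin_span M S"
  by (auto simp: lin_span_def)

lemma lin_span_minimal: "subspace_of N M \<Longrightarrow> S \<subseteq> N \<Longrightarrow> lin_span M S \<subseteq> N"
  by (auto simp: lin_span_def)

lemma subspace_of_lin_span:
  assumes "module base_field M" "S \<subseteq> carrier M"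
  shows "subspace_of (lin_span M S) M"
proof -
  have "subspace_of (carrier M) M"
    by (rule module.carrier_is_submodule[OF assms(1)])
  then have sub: "lin_span M S \<subseteq> carrier M"
    by (rule lin_span_minimal) fact
  show ?thesis
    by (rule subspace_ofI[OF assms(1) sub]) (auto simp: lin_span_def dest: subspace_ofD(2-4))
qed

section \<open>Monoid algebras as spaces of finitely supported functions\<close>

lemma monoid_algebra_simps:
  "carrier (monoid_algebra G) = {p. Poly_Mapping.keys p \<subseteq> carrier G}"
  "\<zero>\<^bsub>monoid_algebra G\<^esub> = 0" "p \<oplus>\<^bsub>monoid_algebra G\<^esub> q = p + q"
  "c \<odot>\<^bsub>monoid_algebra G\<^esub> p = c \<bullet> p" "\<one>\<^bsub>monoid_algebra G\<^esub> = bas \<one>\<^bsub>G\<^esub>"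
  by (simp_all add: monoid_algebra_def scl_def)

lemma monoid_algebra_mult:
  "p \<otimes>\<^bsub>monoid_algebra G\<^esub> q = lext (\<lambda>x. lext (\<lambda>y. bas (x \<otimes>\<^bsub>G\<^esub> y)) q) p"
  by (simp add: monoid_algebra_def lext_def scl_sum_right scl_single)

lemma keys_add_subset: "Poly_Mapping.keys p \<subseteq> K \<Longrightarrow> Poly_Mapping.keys q \<subseteq> K \<Longrightarrow> Poly_Mapping.keys (p + q) \<subseteq> K"
  using keys_add[of p q] by auto

lemma keys_uminus: "Poly_Mapping.keys (- p) = Poly_Mapping.keys p" for p :: "'i \<Rightarrow>\<^sub>0 'k::field"
  by (auto simp: in_keys_iff)

lemma keys_diff_subset: "Poly_Mapping.keys p \<subseteq> K \<Longrightarrow> Poly_Mapping.keys q \<subseteq> K \<Longrightarrow> Poly_Mapping.keys (p - q) \<subseteq> K"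
  for p q :: "'i \<Rightarrow>\<^sub>0 'k::field"
  using keys_add_subset[of p K "- q"] by (simp add: keys_uminus)

lemma keys_lext_subset: "(\<And>i. i \<in> Poly_Mapping.keys p \<Longrightarrow> Poly_Mapping.keys (F i) \<subseteq> K) \<Longrightarrow> Poly_Mapping.keys (lext F p) \<subseteq> K"
  unfolding lext_def
  by (rule order.trans[OF Poly_Mapping.keys_sum]) (use keys_scl in fast)

lemma module_monoid_algebra: "module base_field (monoid_algebra G :: ('k::field, _) module)"
proof (rule moduleI)
  show "cring (base_field :: 'k ring)" by (rule cring_from_type_algebra)
  show "abelian_group (monoid_algebra G :: ('k, _) module)"
  proof (rule abelian_groupI)
    fix x :: "_ \<Rightarrow>\<^sub>0 'k"
    assume "x \<in> carrier (monoid_algebra G)"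
    then show "\<exists>y\<in>carrier (monoid_algebra G). y \<oplus>\<^bsub>monoid_algebra G\<^esub> x = \<zero>\<^bsub>monoid_algebra G\<^esub>"
      by (intro bexI[of _ "- x"]) (auto simp: monoid_algebra_simps keys_uminus)
  qed (auto simp: monoid_algebra_simps add_ac dest: keys_add_subset[THEN subsetD, rotated 2])
qed (use keys_scl in \<open>fastforce simp: monoid_algebra_simps scl_add_left scl_add_right\<close>)+

text \<open>A module with a chosen basis. The module axioms are a consequence, transported along the
  bijection; so exhibiting coordinates on a tensor product also shows that it is a module.\<close>

locale coord =
  fixes A :: "('k::field, 'a) module" (structure) and \<phi> :: "'a \<Rightarrow> ('i \<Rightarrow>\<^sub>0 'k)"
  assumes bij: "bij_betw \<phi> (carrier A) UNIV"
    and zero_in [simp, intro]: "\<zero> \<in> carrier A" and coord_zero [simp]: "\<phi> \<zero> = 0"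
    and add_in [simp, intro]: "x \<in> carrier A \<Longrightarrow> y \<in> carrier A \<Longrightarrow> x \<oplus> y \<in> carrier A"
    and coord_add [simp]: "x \<in> carrier A \<Longrightarrow> y \<in> carrier A \<Longrightarrow> \<phi> (x \<oplus> y) = \<phi> x + \<phi> y"
    and smult_in [simp, intro]: "x \<in> carrier A \<Longrightarrow> c \<odot> x \<in> carrier A"
    and coord_smult [simp]: "x \<in> carrier A \<Longrightarrow> \<phi> (c \<odot> x) = c \<bullet> \<phi> x"
begin

definition vec :: "('i \<Rightarrow>\<^sub>0 'k) \<Rightarrow> 'a" where
  "vec = inv_into (carrier A) \<phi>"

lemma vec_closed [simp, intro]: "vec p \<in> carrier A"
  and coord_vec [simp]: "\<phi> (vec p) = p"
  and vec_coord [simp]: "x \<in> carrier A \<Longrightarrow> vec (\<phi> x) = x"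
  using bij unfolding vec_def bij_betw_def
  by (auto simp: inv_into_into f_inv_into_f inv_into_f_f)

lemma coord_eqI: "x \<in> carrier A \<Longrightarrow> y \<in> carrier A \<Longrightarrow> \<phi> x = \<phi> y \<Longrightarrow> x = y"
  by (metis vec_coord)

lemma vec_add: "vec (p + q) = vec p \<oplus> vec q"
  and vec_scl: "vec (c \<bullet> p) = c \<odot> vec p"
  by (auto intro!: coord_eqI)

lemma module: "module base_field A"
proof (rule moduleI)
  show "cring (base_field :: 'k ring)" by (rule cring_from_type_algebra)
  show "abelian_group A"
  proof (rule abelian_groupI)
    fix x assume "x \<in> carrier A"
    then show "\<exists>y\<in>carrier A. y \<oplus> x = \<zero>"
      by (intro bexI[of _ "vec (- \<phi> x)"]) (auto intro!: coord_eqI)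
  qed (auto intro!: coord_eqI simp: add_ac)
qed (auto intro!: coord_eqI simp: scl_add_left scl_add_right)

sublocale module base_field A
  by (rule module)

lemma coord_finsum:
  assumes "finite K" "f \<in> K \<rightarrow> carrier A"
  shows "\<phi> (finsum A f K) = (\<Sum>k\<in>K. \<phi> (f k))"
  using assms by (induction K rule: finite_induct) (auto simp: finsum_insert Pi_def)

end

section \<open>Coordinates on tensor products\<close>

definition tcoord ::
  "('a \<Rightarrow> ('i \<Rightarrow>\<^sub>0 'k)) \<Rightarrow> ('b \<Rightarrow> ('j \<Rightarrow>\<^sub>0 'k)) \<Rightarrow> ('a \<times> 'b \<Rightarrow>\<^sub>0 'k::field) set \<Rightarrow> ('i \<times> 'j \<Rightarrow>\<^sub>0 'k)" where
  "tcoord \<phi> \<psi> t = lext (\<lambda>(x, y). \<phi> x \<star> \<psi> y) (SOME p. p \<in> t)"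

locale coord_pair = A: coord A \<phi> + B: coord B \<psi>
  for A :: "('k::field, 'a) module" and \<phi> :: "'a \<Rightarrow> ('i \<Rightarrow>\<^sub>0 'k)"
    and B :: "('k, 'b) module" and \<psi> :: "'b \<Rightarrow> ('j \<Rightarrow>\<^sub>0 'k)"
begin

abbreviation free :: "('k, 'a \<times> 'b \<Rightarrow>\<^sub>0 'k) module" where
  "free \<equiv> monoid_algebra (A \<times>\<times> B)"

definition evaluate :: "('a \<times> 'b \<Rightarrow>\<^sub>0 'k) \<Rightarrow> ('i \<times> 'j \<Rightarrow>\<^sub>0 'k)" where
  "evaluate = lext (\<lambda>(x, y). \<phi> x \<star> \<psi> y)"

definition rep :: "('i \<times> 'j \<Rightarrow>\<^sub>0 'k) \<Rightarrow> ('a \<times> 'b \<Rightarrow>\<^sub>0 'k)" where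
  "rep = lext (\<lambda>(i, j). bas (A.vec (bas i), B.vec (bas j)))"

lemma lin_evaluate [simp, intro]: "lin evaluate" and lin_rep [simp, intro]: "lin rep"
  by (simp_all add: evaluate_def rep_def)

lemmas evaluate_simps [simp] = lin_simps[OF lin_evaluate]

lemma evaluate_bas [simp]: "evaluate (bas (x, y)) = \<phi> x \<star> \<psi> y"
  by (simp add: evaluate_def)

lemma rep_bas [simp]: "rep (bas (i, j)) = bas (A.vec (bas i), B.vec (bas j))"
  by (simp add: rep_def)

lemma evaluate_rep [simp]: "evaluate (rep w) = w"
  by (rule lin_eqI[of "\<lambda>w. evaluate (rep w)"]) (auto simp: lin_def lin_simps[OF lin_rep])

lemma carrier_free: "carrier free = {p. Poly_Mapping.keys p \<subseteq> carrier A \<times> carrier B}"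
  by (simp add: monoid_algebra_simps)

lemma rep_closed [simp, intro]: "rep w \<in> carrier free"
proof -
  have "Poly_Mapping.keys (rep w) \<subseteq> carrier A \<times> carrier B"
    unfolding rep_def by (rule keys_lext_subset) (auto split: prod.split)
  then show ?thesis by (simp add: carrier_free)
qed

lemma bas_closed: "x \<in> carrier A \<Longrightarrow> y \<in> carrier B \<Longrightarrow> bas (x, y) \<in> carrier free"
  by (simp add: carrier_free)

lemma free_closed: "p \<in> carrier free \<Longrightarrow> q \<in> carrier free \<Longrightarrow> p + q \<in> carrier free"
  "p \<in> carrier free \<Longrightarrow> q \<in> carrier free \<Longrightarrow> p - q \<in> carrier free"
  "p \<in> carrier free \<Longrightarrow> c \<bullet> p \<in> carrier free" "0 \<in> carrier free"
  using keys_add_subset[of p _ q] keys_diff_subset[of p _ q] keys_scl[of c p]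
  unfolding carrier_free by auto

lemma tensor_relations_subset:
  "tensor_relations A B \<subseteq> {p \<in> carrier free. evaluate p = 0}"
proof -
  have 1: "bas (x \<oplus>\<^bsub>A\<^esub> x', y) - bas (x, y) - bas (x', y) \<in> {p \<in> carrier free. evaluate p = 0}"
    if "x \<in> carrier A" "x' \<in> carrier A" "y \<in> carrier B" for x x' y
    using that by (auto intro!: free_closed bas_closed simp: tens_simps)
  have 2: "bas (x, y \<oplus>\<^bsub>B\<^esub> y') - bas (x, y) - bas (x, y') \<in> {p \<in> carrier free. evaluate p = 0}"
    if "x \<in> carrier A" "y \<in> carrier B" "y' \<in> carrier B" for x y y'
    using that by (auto intro!: free_closed bas_closed simp: tens_simps)
  have 3: "bas (c \<odot>\<^bsub>A\<^esub> x, y) - c \<bullet> bas (x, y) \<in> {p \<in> carrier free. evaluate p = 0}"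
    if "x \<in> carrier A" "y \<in> carrier B" for x y c
    using that by (auto intro!: free_closed bas_closed simp: tens_simps)
  have 4: "bas (x, c \<odot>\<^bsub>B\<^esub> y) - c \<bullet> bas (x, y) \<in> {p \<in> carrier free. evaluate p = 0}"
    if "x \<in> carrier A" "y \<in> carrier B" for x y c
    using that by (auto intro!: free_closed bas_closed simp: tens_simps)
  show ?thesis
    unfolding tensor_relations_def using 1 2 3 4 by (auto simp: scl_single)
qed

text \<open>Modulo the bilinearity relations every formal sum reduces to a normal form supported on
  pairs of basis vectors. It is stated for any subspace \<open>N\<close> containing the relations
  because \<open>lin_span\<close> is the intersection of all of these.\<close>

lemma diff_rep_evaluate_in:
  assumes N: "subspace_of N free" "tensor_relations A B \<subseteq> N" and p: "p \<in> carrier free"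
  shows "p - rep (evaluate p) \<in> N"
proof -
  have N_add: "u + v \<in> N" if "u \<in> N" "v \<in> N" for u v
    using subspace_ofD(3)[OF N(1) that] by (simp add: monoid_algebra_simps)
  have N_scl: "c \<bullet> u \<in> N" if "u \<in> N" for c u
    using subspace_ofD(4)[OF N(1) that] by (simp add: monoid_algebra_simps)
  have N_zero: "0 \<in> N"
    using subspace_ofD(2)[OF N(1)] by (simp add: monoid_algebra_simps)
  note rep_lin = lin_simps[OF lin_rep]
  have right: "bas (A.vec (bas i), B.vec v) - rep (bas i \<star> v) \<in> N" for i v
  proof (induction v rule: poly_mapping_linear_induct)
    case (add p q)
    let ?x = "A.vec (bas i)"
    have "bas (?x, B.vec (p + q)) - bas (?x, B.vec p) - bas (?x, B.vec q) \<in> N"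
      using N(2) unfolding B.vec_add tensor_relations_def by blast
    from N_add[OF N_add[OF this add(1)] add(2)] show ?case
      by (simp add: rep_lin tens_simps algebra_simps)
  next
    case (scale c p)
    let ?x = "A.vec (bas i)"
    have "bas (?x, B.vec (c \<bullet> p)) - Poly_Mapping.single (?x, B.vec p) c \<in> N"
      using N(2) unfolding B.vec_scl tensor_relations_def by blast
    then have "bas (?x, B.vec (c \<bullet> p)) - c \<bullet> bas (?x, B.vec p) \<in> N"
      by (simp add: scl_single)
    from N_add[OF this N_scl[OF scale, of c]] show ?case
      by (simp add: rep_lin tens_simps algebra_simps scl_diff_right)
  qed (simp add: N_zero)
  have pure: "bas (A.vec u, B.vec v) - rep (u \<star> v) \<in> N" for u v
  proof (induction u rule: poly_mapping_linear_induct)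
    case (basis i)
    show ?case by (rule right)
  next
    case (add p q)
    let ?y = "B.vec v"
    have "bas (A.vec (p + q), ?y) - bas (A.vec p, ?y) - bas (A.vec q, ?y) \<in> N"
      using N(2) unfolding A.vec_add tensor_relations_def by blast
    from N_add[OF N_add[OF this add(1)] add(2)] show ?case
      by (simp add: rep_lin tens_simps algebra_simps)
  next
    case (scale c p)
    let ?y = "B.vec v"
    have "bas (A.vec (c \<bullet> p), ?y) - Poly_Mapping.single (A.vec p, ?y) c \<in> N"
      using N(2) unfolding A.vec_scl tensor_relations_def by blast
    then have "bas (A.vec (c \<bullet> p), ?y) - c \<bullet> bas (A.vec p, ?y) \<in> N"
      by (simp add: scl_single)
    from N_add[OF this N_scl[OF scale, of c]] show ?case
      by (simp add: rep_lin tens_simps algebra_simps scl_diff_right)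
  qed
  have lin: "lin (\<lambda>p. p - rep (evaluate p))"
    by (simp add: lin_def rep_lin scl_diff_right)
  have sum: "(\<Sum>z\<in>K. f z) \<in> N" if "\<And>z. z \<in> K \<Longrightarrow> f z \<in> N" for K f
    using that by (induction K rule: infinite_finite_induct) (auto intro: N_add N_zero)
  have "p - rep (evaluate p) = lext (\<lambda>z. bas z - rep (evaluate (bas z))) p"
    by (rule lin_eq_lext[OF lin])
  also have "\<dots> \<in> N"
    unfolding lext_def
  proof (intro sum N_scl)
    fix z assume "z \<in> Poly_Mapping.keys p"
    then obtain x y where "z = (x, y)" "x \<in> carrier A" "y \<in> carrier B"
      using p by (auto simp: carrier_free)
    then show "bas z - rep (evaluate (bas z)) \<in> N"
      using pure[of "\<phi> x" "\<psi> y"] by simp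
  qed
  finally show ?thesis .
qed

text \<open>Evaluation kills each relation. Conversely, if \<open>evaluate p = 0\<close> then the
  normal form of \<open>p\<close> is 0, so \<open>p\<close> itself lies in every subspace containing
  the relations.\<close>

lemma tensor_null_eq: "tensor_null A B = {p \<in> carrier free. evaluate p = 0}"
proof (rule antisym)
  show "tensor_null A B \<subseteq> {p \<in> carrier free. evaluate p = 0}"
    unfolding tensor_null_def
  proof (rule lin_span_minimal[OF _ tensor_relations_subset])
    show "subspace_of {p \<in> carrier free. evaluate p = 0} free"
      by (rule subspace_ofI[OF module_monoid_algebra])
        (auto simp: monoid_algebra_simps(2-) intro: free_closed)
  qed
next
  show "{p \<in> carrier free. evaluate p = 0} \<subseteq> tensor_null A B"
    unfolding tensor_null_def lin_span_def
    using diff_rep_evaluate_in by (fastforce simp: lin_simps[OF lin_rep])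
qed

text \<open>The cosets of \<open>tensor_null\<close> are exactly these fibres, so the elements of
  the tensor product are indexed by \<open>w\<close>.\<close>

definition fib :: "('i \<times> 'j \<Rightarrow>\<^sub>0 'k) \<Rightarrow> ('a \<times> 'b \<Rightarrow>\<^sub>0 'k) set" where
  "fib w = {p \<in> carrier free. evaluate p = w}"

lemma coset_eq_fib:
  assumes "p \<in> carrier free"
  shows "tensor_null A B +>\<^bsub>free\<^esub> p = fib (evaluate p)"
proof -
  have "q \<in> tensor_null A B +>\<^bsub>free\<^esub> p" if "q \<in> fib (evaluate p)" for q
    using that free_closed(2)[OF _ assms, of q]
    unfolding a_r_coset_def r_coset_def
    by (auto simp: tensor_null_eq fib_def monoid_algebra_simps(3) intro!: bexI[of _ "q - p"])
  moreover have "tensor_null A B +>\<^bsub>free\<^esub> p \<subseteq> fib (evaluate p)"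
    using assms free_closed(1)
    by (auto simp: a_r_coset_def r_coset_def tensor_null_eq fib_def monoid_algebra_simps(3))
  ultimately show ?thesis by auto
qed

lemma rep_in_fib [simp, intro]: "rep w \<in> fib w"
  by (simp add: fib_def)

lemma tcoord_fib [simp]: "tcoord \<phi> \<psi> (fib w) = w"
proof -
  have "(SOME p. p \<in> fib w) \<in> fib w" by (rule someI) (rule rep_in_fib)
  then show ?thesis by (simp add: tcoord_def evaluate_def fib_def)
qed

lemma carrier_tensor: "carrier (tensor A B) = range fib"
proof -
  have "carrier (tensor A B) = (\<lambda>p. tensor_null A B +>\<^bsub>free\<^esub> p) ` carrier free"
    by (auto simp: tensor_def quotient_algebra_def FactRing_def A_RCOSETS_def RCOSETS_def
        a_r_coset_def)
  also have "\<dots> = (\<lambda>p. fib (evaluate p)) ` carrier free"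
    by (intro image_cong refl coset_eq_fib)
  also have "\<dots> = range fib"
    by (auto simp: image_iff) (metis rep_closed evaluate_rep)
  finally show ?thesis .
qed

lemma zero_tensor: "\<zero>\<^bsub>tensor A B\<^esub> = fib 0"
  by (simp add: tensor_def quotient_algebra_def FactRing_def tensor_null_eq fib_def)

lemma add_tensor: "fib u \<oplus>\<^bsub>tensor A B\<^esub> fib v = fib (u + v)"
proof -
  have "fib u \<oplus>\<^bsub>tensor A B\<^esub> fib v = {p + q | p q. p \<in> fib u \<and> q \<in> fib v}"
    by (auto simp: tensor_def quotient_algebra_def FactRing_def set_add_def set_mult_def
        monoid_algebra_simps(3))
  also have "\<dots> = fib (u + v)"
  proof safe
    fix p assume p: "p \<in> fib (u + v)"
    show "\<exists>q r. p = q + r \<and> q \<in> fib u \<and> r \<in> fib v"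
      using p free_closed(2)[of p "rep u"]
      by (intro exI[of _ "rep u"] exI[of _ "p - rep u"]) (auto simp: fib_def)
  qed (auto simp: fib_def free_closed)
  finally show ?thesis .
qed

lemma smult_tensor: "c \<odot>\<^bsub>tensor A B\<^esub> fib u = fib (c \<bullet> u)"
proof -
  have "c \<odot>\<^bsub>tensor A B\<^esub> fib u = (\<Union>p\<in>fib u. tensor_null A B +>\<^bsub>free\<^esub> (c \<bullet> p))"
    by (simp add: tensor_def quotient_algebra_def monoid_algebra_simps(4))
  also have "\<dots> = (\<Union>p\<in>fib u. fib (c \<bullet> u))"
    by (intro SUP_cong refl) (auto simp: coset_eq_fib free_closed fib_def)
  also have "\<dots> = fib (c \<bullet> u)"
    using rep_in_fib by blast
  finally show ?thesis .
qed

lemma pure_tensor_eq: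
  "x \<in> carrier A \<Longrightarrow> y \<in> carrier B \<Longrightarrow> pure_tensor A B x y = fib (\<phi> x \<star> \<psi> y)"
  by (simp add: pure_tensor_def coset_eq_fib bas_closed)

lemma one_tensor:
  "\<one>\<^bsub>A\<^esub> \<in> carrier A \<Longrightarrow> \<one>\<^bsub>B\<^esub> \<in> carrier B \<Longrightarrow> \<one>\<^bsub>tensor A B\<^esub> = fib (\<phi> \<one>\<^bsub>A\<^esub> \<star> \<psi> \<one>\<^bsub>B\<^esub>)"
  by (simp add: tensor_def quotient_algebra_def FactRing_def monoid_algebra_simps(5) coset_eq_fib bas_closed)

text \<open>By bilinearity it suffices to know the coordinate product \<open>\<mu>\<close> on
  elementary tensors. The product of two cosets is a union over all representatives, and all members
  of the union are the same fibre.\<close>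

lemma mult_tensor:
  assumes "bilin \<mu>"
    and \<mu>: "\<And>x x' y y'. x \<in> carrier A \<Longrightarrow> x' \<in> carrier A \<Longrightarrow> y \<in> carrier B \<Longrightarrow> y' \<in> carrier B \<Longrightarrow>
      x \<otimes>\<^bsub>A\<^esub> x' \<in> carrier A \<and> y \<otimes>\<^bsub>B\<^esub> y' \<in> carrier B \<and>
      \<phi> (x \<otimes>\<^bsub>A\<^esub> x') \<star> \<psi> (y \<otimes>\<^bsub>B\<^esub> y') = \<mu> (\<phi> x \<star> \<psi> y) (\<phi> x' \<star> \<psi> y')"
  shows "fib u \<otimes>\<^bsub>tensor A B\<^esub> fib v = fib (\<mu> u v)"
proof -
  have closed: "p \<otimes>\<^bsub>free\<^esub> q \<in> carrier free" if "p \<in> carrier free" "q \<in> carrier free" for p q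
  proof -
    have "Poly_Mapping.keys (p \<otimes>\<^bsub>free\<^esub> q) \<subseteq> carrier A \<times> carrier B"
      unfolding monoid_algebra_mult
    proof (intro keys_lext_subset)
      fix z z' assume "z \<in> Poly_Mapping.keys p" "z' \<in> Poly_Mapping.keys q"
      then have "z \<in> carrier A \<times> carrier B" "z' \<in> carrier A \<times> carrier B"
        using that by (auto simp: carrier_free)
      then show "Poly_Mapping.keys (bas (z \<otimes>\<^bsub>A \<times>\<times> B\<^esub> z')) \<subseteq> carrier A \<times> carrier B"
        using \<mu> by (cases z; cases z') auto
    qed
    then show ?thesis by (simp add: carrier_free)
  qed
  have evaluate: "evaluate (p \<otimes>\<^bsub>free\<^esub> q) = \<mu> (evaluate p) (evaluate q)"
    if "p \<in> carrier free" "q \<in> carrier free" for p q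
  proof -
    have inner: "evaluate (bas (z \<otimes>\<^bsub>A \<times>\<times> B\<^esub> z')) = \<mu> (evaluate (bas z)) (evaluate (bas z'))"
      if "z \<in> carrier A \<times> carrier B" "z' \<in> carrier A \<times> carrier B" for z z'
      using that \<mu> by (cases z; cases z') simp
    have "evaluate (p \<otimes>\<^bsub>free\<^esub> q) = lext (\<lambda>z. lext (\<lambda>z'. evaluate (bas (z \<otimes>\<^bsub>A \<times>\<times> B\<^esub> z'))) q) p"
      by (simp only: monoid_algebra_mult lin_lext_commute[OF lin_evaluate])
    also have "\<dots> = lext (\<lambda>z. lext (\<lambda>z'. \<mu> (evaluate (bas z)) (evaluate (bas z'))) q) p"
      unfolding lext_def using that
      by (intro sum.cong refl arg_cong[of _ _ "scl c" for c] inner) (auto simp: carrier_free)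
    also have "\<dots> = lext (\<lambda>z. \<mu> (evaluate (bas z)) (evaluate q)) p"
      by (simp only: lin_eq_lext[symmetric, OF lin_compose[OF bilin_right[OF assms(1)] lin_evaluate]])
    also have "\<dots> = \<mu> (evaluate p) (evaluate q)"
      by (rule lin_eq_lext[symmetric, OF lin_compose[OF bilin_left[OF assms(1)] lin_evaluate]])
    finally show ?thesis .
  qed
  have "fib u \<otimes>\<^bsub>tensor A B\<^esub> fib v = (\<Union>p\<in>fib u. \<Union>q\<in>fib v. tensor_null A B +>\<^bsub>free\<^esub> (p \<otimes>\<^bsub>free\<^esub> q))"
    by (simp add: tensor_def quotient_algebra_def FactRing_def rcoset_mult_def)
  also have "\<dots> = (\<Union>p\<in>fib u. \<Union>q\<in>fib v. fib (\<mu> u v))"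
    by (intro SUP_cong refl) (auto simp: coset_eq_fib closed evaluate fib_def)
  also have "\<dots> = fib (\<mu> u v)"
    using rep_in_fib by blast
  finally show ?thesis .
qed

lemma coord_tensor: "coord (tensor A B) (tcoord \<phi> \<psi>)"
proof
  show "bij_betw (tcoord \<phi> \<psi>) (carrier (tensor A B)) UNIV"
    unfolding carrier_tensor by (rule bij_betwI[of _ _ _ fib]) auto
qed (auto simp: carrier_tensor zero_tensor add_tensor smult_tensor)

text \<open>\<open>tensor_lift\<close> sums over one chosen representative; in coordinates the sum
  depends on the evaluation of that representative alone, which is constant on the coset. Through
  this lemma each Hopf axiom becomes an identity in coordinates.\<close>

lemma tensor_lift_coord:
  assumes "coord P \<chi>" "bilin b"
    and \<beta>: "\<And>x y. x \<in> carrier A \<Longrightarrow> y \<in> carrier B \<Longrightarrow> \<beta> x y \<in> carrier P \<and> \<chi> (\<beta> x y) = b (\<phi> x) (\<psi> y)"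
    and t: "t \<in> carrier (tensor A B)"
  shows "tensor_lift P \<beta> t \<in> carrier P" "\<chi> (tensor_lift P \<beta> t) = blift b (tcoord \<phi> \<psi> t)"
proof -
  interpret P: coord P \<chi> by fact
  define p where "p = (SOME p. p \<in> t)"
  obtain w where w: "t = fib w" using t by (auto simp: carrier_tensor)
  have "p \<in> fib w" unfolding p_def w by (rule someI) (rule rep_in_fib)
  then have p: "Poly_Mapping.keys p \<subseteq> carrier A \<times> carrier B" "evaluate p = w"
    by (auto simp: fib_def carrier_free)
  let ?f = "\<lambda>(x, y). Poly_Mapping.lookup p (x, y) \<odot>\<^bsub>P\<^esub> \<beta> x y"
  have f: "?f \<in> Poly_Mapping.keys p \<rightarrow> carrier P"
    using p(1) \<beta> by auto
  have eq: "tensor_lift P \<beta> t = finsum P ?f (Poly_Mapping.keys p)"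
    by (simp add: tensor_lift_def p_def Let_def)
  show "tensor_lift P \<beta> t \<in> carrier P"
    unfolding eq using f by (rule P.finsum_closed)
  have "\<chi> (tensor_lift P \<beta> t) = (\<Sum>z\<in>Poly_Mapping.keys p. \<chi> (?f z))"
    unfolding eq by (rule P.coord_finsum[OF finite_keys f])
  also have "\<dots> = lext (\<lambda>z. blift b (evaluate (bas z))) p"
    unfolding lext_def using p(1) \<beta>
    by (intro sum.cong) (auto simp: blift_tens[OF assms(2)])
  also have "\<dots> = blift b (evaluate p)"
    using lin_eq_lext[of "\<lambda>p. blift b (evaluate p)" p] by (simp add: lin_def lin_simps[OF lin_blift])
  finally show "\<chi> (tensor_lift P \<beta> t) = blift b (tcoord \<phi> \<psi> t)"
    by (simp add: p(2) w)
qed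

lemma tcoord_pure_tensor:
  assumes "x \<in> carrier A" "y \<in> carrier B"
  shows "pure_tensor A B x y \<in> carrier (tensor A B)" "tcoord \<phi> \<psi> (pure_tensor A B x y) = \<phi> x \<star> \<psi> y"
  using assms by (simp_all add: pure_tensor_eq carrier_tensor)

end

section \<open>The Hopf algebra\<close>

text \<open>The carrier consists of functions on lists of naturals, whereas monomials are indexed by
  triples; the two are matched through their codes in \<open>nat\<close>.\<close>

definition list_idx :: "nat list \<Rightarrow> nat \<times> nat \<times> nat" where
  "list_idx l = map_prod id prod_decode (prod_decode (list_encode l))"

lemma bij_list_idx: "bij list_idx"
proof (rule o_bij)
  let ?g = "\<lambda>(b, c, a). list_decode (prod_encode (b, prod_encode (c, a)))"
  have "?g (list_idx l) = l" for l
  proof -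
    obtain b m where 1: "prod_decode (list_encode l) = (b, m)" by fastforce
    obtain c a where 2: "prod_decode m = (c, a)" by fastforce
    have "prod_encode (c, a) = m" "prod_encode (b, m) = list_encode l"
      by (simp_all flip: 1 2)
    then show ?thesis by (simp add: list_idx_def 1 2)
  qed
  then show "?g \<circ> list_idx = id" by auto
  show "list_idx \<circ> ?g = id" by (auto simp: list_idx_def)
qed

definition hcoord :: "(nat list \<Rightarrow>\<^sub>0 'k::field) \<Rightarrow> (nat \<times> nat \<times> nat \<Rightarrow>\<^sub>0 'k)" where
  "hcoord = lext (\<lambda>l. bas (list_idx l))"

definition hvec :: "(nat \<times> nat \<times> nat \<Rightarrow>\<^sub>0 'k::field) \<Rightarrow> (nat list \<Rightarrow>\<^sub>0 'k)" where
  "hvec = lext (\<lambda>i. bas (inv_into UNIV list_idx i))"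

lemma lin_hcoord [simp, intro]: "lin hcoord" and lin_hvec [simp, intro]: "lin hvec"
  by (simp_all add: hcoord_def hvec_def)

lemmas hcoord_simps [simp] = lin_simps[OF lin_hcoord]
lemmas hvec_simps [simp] = lin_simps[OF lin_hvec]

lemma hcoord_hvec [simp]: "hcoord (hvec p) = p"
proof (rule lin_eqI[of "\<lambda>p. hcoord (hvec p)" "\<lambda>p. p"])
  show "hcoord (hvec (bas i)) = bas i" for i
    using bij_list_idx by (simp add: hcoord_def hvec_def bij_def surj_f_inv_f)
qed (simp_all add: lin_def)

lemma hvec_hcoord [simp]: "hvec (hcoord p) = p"
proof (rule lin_eqI[of "\<lambda>p. hvec (hcoord p)" "\<lambda>p. p"])
  show "hvec (hcoord (bas l)) = bas l" for l
    using bij_list_idx by (simp add: hcoord_def hvec_def bij_def)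
qed (simp_all add: lin_def)

text \<open>
  This is \<open>B(0)\<close> in Zhuang's classification of connected Hopf algebras of Gelfand--Kirillov
  dimension three.
\<close>

definition hopf_B :: "('k::field_char_0, nat list \<Rightarrow>\<^sub>0 'k) module" where
  "hopf_B = \<lparr> carrier = UNIV, monoid.mult = (\<lambda>x y. hvec (pbw_mult (hcoord x) (hcoord y))),
     one = hvec pbw_one, ring.zero = 0, add = (+), module.smult = scl \<rparr>"

lemma hopf_B_simps [simp]:
  "carrier hopf_B = UNIV" "x \<otimes>\<^bsub>hopf_B\<^esub> y = hvec (pbw_mult (hcoord x) (hcoord y))"
  "\<one>\<^bsub>hopf_B\<^esub> = hvec pbw_one" "\<zero>\<^bsub>hopf_B\<^esub> = 0" "x \<oplus>\<^bsub>hopf_B\<^esub> y = x + y"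
  "c \<odot>\<^bsub>hopf_B\<^esub> x = c \<bullet> x"
  by (simp_all add: hopf_B_def)

lemma coord_hopf_B: "coord hopf_B hcoord"
  by unfold_locales (auto intro!: bij_betwI[of _ _ _ hvec])

interpretation H: coord hopf_B hcoord
  by (rule coord_hopf_B)

interpretation HH: coord_pair hopf_B hcoord hopf_B hcoord
  by unfold_locales

interpretation HH_H: coord_pair "tensor hopf_B hopf_B" "tcoord hcoord hcoord" hopf_B hcoord
  by (intro coord_pair.intro HH.coord_tensor coord_hopf_B)

interpretation H_HH: coord_pair hopf_B hcoord "tensor hopf_B hopf_B" "tcoord hcoord hcoord"
  by (intro coord_pair.intro HH.coord_tensor coord_hopf_B)

lemma ring_hopf_B: "ring hopf_B"
proof (rule ringI)
  show "abelian_group hopf_B" by (rule H.abelian_group_axioms)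
  show "Group.monoid hopf_B" by (rule monoidI) (simp_all add: mult_assoc)
qed simp_all

definition hcomult :: "(nat list \<Rightarrow>\<^sub>0 'k::field_char_0) \<Rightarrow> _" where
  "hcomult h = HH.fib (comult (hcoord h))"

definition hcounit :: "(nat list \<Rightarrow>\<^sub>0 'k::field_char_0) \<Rightarrow> 'k" where
  "hcounit h = counit (hcoord h)"

definition hantipode :: "(nat list \<Rightarrow>\<^sub>0 'k::field_char_0) \<Rightarrow> _" where
  "hantipode h = hvec (antipode (hcoord h))"

lemma hcomult_closed [simp, intro]: "hcomult h \<in> carrier (tensor hopf_B hopf_B)"
  and tcoord_hcomult [simp]: "tcoord hcoord hcoord (hcomult h) = comult (hcoord h)"
  by (simp_all add: hcomult_def HH.carrier_tensor)

lemma hcomult_linear: "linear_map hopf_B (tensor hopf_B hopf_B) hcomult"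
  by (auto simp: linear_map_def) (simp_all add: hcomult_def HH.add_tensor HH.smult_tensor)

lemma hcomult_hom: "hcomult \<in> ring_hom hopf_B (tensor hopf_B hopf_B)"
proof (rule ring_hom_memI)
  fix x y :: "nat list \<Rightarrow>\<^sub>0 'k::field_char_0"
  show "hcomult (x \<otimes>\<^bsub>hopf_B\<^esub> y) = hcomult x \<otimes>\<^bsub>tensor hopf_B hopf_B\<^esub> hcomult y"
    unfolding hcomult_def
    by (subst HH.mult_tensor[OF bilin_tens_mult]) (auto simp: comult_mult)
qed (simp_all add: hcomult_def HH.add_tensor HH.one_tensor HH.carrier_tensor)

lemmas HH_lift = HH.tensor_lift_coord[OF coord_hopf_B]

lemma hopf_B_hopf_algebra:
  "hopf_algebra (hopf_B :: ('k::field_char_0, _) module) hcomult hcounit hantipode"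
  (is "hopf_algebra ?H _ _ _")
proof
  show "k_algebra ?H"
    by (auto simp: k_algebra_def ring_hopf_B H.module)
  show "linear_map ?H (tensor ?H ?H) hcomult" by (rule hcomult_linear)
  show "hcomult \<in> ring_hom ?H (tensor ?H ?H)" by (rule hcomult_hom)
  show "hcounit (c \<odot>\<^bsub>?H\<^esub> x) = c * hcounit x" for c x
    by (simp add: hcounit_def)
  show "hcounit \<in> ring_hom ?H base_field"
    by (rule ring_hom_memI) (auto simp: hcounit_def counit_mult)
  show "linear_map ?H ?H hantipode"
    by (simp add: linear_map_def hantipode_def lin_simps[OF lin_antipode])
next
  fix h :: "nat list \<Rightarrow>\<^sub>0 'k"
  \<comment> \<open>Both sides of coassociativity are nested lifts. \<open>L\<close>,
    \<open>R\<close> and \<open>A\<close> compute their coordinates one lift at a time, which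
    reduces the claim to \<open>coassoc\<close>.\<close>
  have b1: "bilin (\<lambda>x y. comult x \<star> (y :: 'k pbw))" and b2: "bilin (\<lambda>(x :: 'k pbw) y. x \<star> comult y)"
    by (intro bilinI lin_tens_left lin_tens_right lin_comult lin_id)+
  have pt: "pure_tensor (tensor ?H ?H) ?H (hcomult x) (id y) \<in> carrier (tensor (tensor ?H ?H) ?H) \<and>
     tcoord (tcoord hcoord hcoord) hcoord (pure_tensor (tensor ?H ?H) ?H (hcomult x) (id y)) = comult (hcoord x) \<star> hcoord y"
    for x y by (simp add: HH_H.tcoord_pure_tensor)
  note L = HH.tensor_lift_coord[OF HH_H.coord_tensor b1 pt hcomult_closed[of h], folded tensor_map_def]
  have pt: "pure_tensor ?H (tensor ?H ?H) (id x) (hcomult y) \<in> carrier (tensor ?H (tensor ?H ?H)) \<and>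
     tcoord hcoord (tcoord hcoord hcoord) (pure_tensor ?H (tensor ?H ?H) (id x) (hcomult y)) = hcoord x \<star> comult (hcoord y)"
    for x y by (simp add: H_HH.tcoord_pure_tensor)
  note R = HH.tensor_lift_coord[OF H_HH.coord_tensor b2 pt hcomult_closed[of h], folded tensor_map_def]
  have pt: "pure_tensor ?H (tensor ?H ?H) x (pure_tensor ?H ?H y z) \<in> carrier (tensor ?H (tensor ?H ?H)) \<and>
     tcoord hcoord (tcoord hcoord hcoord) (pure_tensor ?H (tensor ?H ?H) x (pure_tensor ?H ?H y z)) = hcoord x \<star> (hcoord y \<star> hcoord z)"
    for x y z by (simp add: H_HH.tcoord_pure_tensor HH.tcoord_pure_tensor)
  have inner: "tensor_lift (tensor ?H (tensor ?H ?H))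
        (\<lambda>x y. pure_tensor ?H (tensor ?H ?H) x (pure_tensor ?H ?H y z)) u \<in> carrier (tensor ?H (tensor ?H ?H)) \<and>
      tcoord hcoord (tcoord hcoord hcoord) (tensor_lift (tensor ?H (tensor ?H ?H))
        (\<lambda>x y. pure_tensor ?H (tensor ?H ?H) x (pure_tensor ?H ?H y z)) u) =
      blift (\<lambda>x y. x \<star> (y \<star> hcoord z)) (tcoord hcoord hcoord u)"
    if "u \<in> carrier (tensor ?H ?H)" for u z
    using HH.tensor_lift_coord[OF H_HH.coord_tensor bilin_assoc_inner pt that] by blast
  let ?L = "tensor_map (tensor ?H ?H) ?H hcomult id (hcomult h)"
  have A: "tensor_assoc ?H ?H ?H ?L \<in> carrier (tensor ?H (tensor ?H ?H))"
    "tcoord hcoord (tcoord hcoord hcoord) (tensor_assoc ?H ?H ?H ?L) =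
      blift (\<lambda>u z. blift (\<lambda>x y. x \<star> (y \<star> z)) u) (tcoord (tcoord hcoord hcoord) hcoord ?L)"
    unfolding tensor_assoc_def
    by (rule HH_H.tensor_lift_coord[OF H_HH.coord_tensor bilin_assoc_outer _ L(1)]; rule inner; assumption)+
  show "tensor_assoc ?H ?H ?H (tensor_map (tensor ?H ?H) ?H hcomult id (hcomult h)) =
      tensor_map ?H (tensor ?H ?H) id hcomult (hcomult h)"
  proof (rule coord.coord_eqI[OF H_HH.coord_tensor A(1) R(1)])
    show "tcoord hcoord (tcoord hcoord hcoord) (tensor_assoc ?H ?H ?H (tensor_map (tensor ?H ?H) ?H hcomult id (hcomult h))) =
      tcoord hcoord (tcoord hcoord hcoord) (tensor_map ?H (tensor ?H ?H) id hcomult (hcomult h))"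
      unfolding A(2) R(2) L(2) using coassoc[of "hcoord h"]
      by (simp add: tmap_def assoc_lin_def)
  qed
  show "tensor_lift ?H (\<lambda>x y. hcounit x \<odot>\<^bsub>?H\<^esub> y) (hcomult h) = h"
    by (rule H.coord_eqI; (subst HH_lift(2)[OF bilin_counit(1)])?)
      (auto simp: hcounit_def counit_left)
  show "tensor_lift ?H (\<lambda>x y. hcounit y \<odot>\<^bsub>?H\<^esub> x) (hcomult h) = h"
    by (rule H.coord_eqI; (subst HH_lift(2)[OF bilin_counit(2)])?)
      (auto simp: hcounit_def counit_right)
  show "tensor_lift ?H (\<lambda>x y. hantipode x \<otimes>\<^bsub>?H\<^esub> y) (hcomult h) = hcounit h \<odot>\<^bsub>?H\<^esub> \<one>\<^bsub>?H\<^esub>"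
    by (rule H.coord_eqI; (subst HH_lift(2)[OF bilin_antipode_left])?)
      (auto simp: hcounit_def hantipode_def antipode_left)
  show "tensor_lift ?H (\<lambda>x y. x \<otimes>\<^bsub>?H\<^esub> hantipode y) (hcomult h) = hcounit h \<odot>\<^bsub>?H\<^esub> \<one>\<^bsub>?H\<^esub>"
    by (rule H.coord_eqI; (subst HH_lift(2)[OF bilin_antipode_right])?)
      (auto simp: hcounit_def hantipode_def antipode_right)
qed

section \<open>Connectedness\<close>

text \<open>Z has weight 2 so that X, the left factor of X tensor Y in Delta Z, has smaller degree
  than Z. With weight 1 the leading term of Delta Z would not be Z tensor 1 alone.\<close>

fun pbw_deg :: "nat \<times> nat \<times> nat \<Rightarrow> nat" where
  "pbw_deg (b, c, a) = b + 2 * c + a"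

text \<open>The bound is strict, so that \<open>low 0\<close> is zero and an error term below degree
  0 vanishes.\<close>

definition low :: "nat \<Rightarrow> 'k::field_char_0 pbw set" where
  "low n = {p. \<forall>i\<in>Poly_Mapping.keys p. pbw_deg i < n}"

lemma low_add: "p \<in> low n \<Longrightarrow> q \<in> low n \<Longrightarrow> p + q \<in> low n"
  and low_scl: "p \<in> low n \<Longrightarrow> c \<bullet> p \<in> low n"
  and low_zero [simp]: "0 \<in> low n"
  and low_mono: "p \<in> low n \<Longrightarrow> n \<le> m \<Longrightarrow> p \<in> low m"
  and low_bas [simp]: "bas i \<in> low n \<longleftrightarrow> pbw_deg i < n"
  using keys_add[of p q] keys_scl[of c p] by (fastforce simp: low_def)+

lemma low_lext:
  assumes "p \<in> low n" "\<And>i. pbw_deg i < n \<Longrightarrow> F i \<in> low m"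
  shows "lext F p \<in> low m"
  using keys_lext_subset[of p F "{i. pbw_deg i < m}"] assms by (fastforce simp: low_def)

lemma low_L:
  assumes "p \<in> low n"
  shows "LX p \<in> low (Suc n)" "LY p \<in> low (Suc n)" "LZ p \<in> low (Suc (Suc n))"
  using assms unfolding LX_def LY_def LZ_def
  by (auto intro!: low_lext low_add low_scl split: prod.split)

text \<open>The degree of the right factor is left free, since the argument contracts left
  factors.\<close>

definition low2 :: "nat \<Rightarrow> ((nat \<times> nat \<times> nat) \<times> nat \<times> nat \<times> nat \<Rightarrow>\<^sub>0 'k::field_char_0) set" where
  "low2 n = {w. \<forall>i\<in>Poly_Mapping.keys w. pbw_deg (fst i) < n}"

lemma low2_add: "p \<in> low2 n \<Longrightarrow> q \<in> low2 n \<Longrightarrow> p + q \<in> low2 n"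
  and low2_scl: "p \<in> low2 n \<Longrightarrow> c \<bullet> p \<in> low2 n"
  and low2_zero [simp]: "0 \<in> low2 n"
  and low2_mono: "p \<in> low2 n \<Longrightarrow> n \<le> m \<Longrightarrow> p \<in> low2 m"
  using keys_add[of p q] keys_scl[of c p] by (fastforce simp: low2_def)+

lemma keys_tens: "Poly_Mapping.keys (x \<star> y) \<subseteq> Poly_Mapping.keys x \<times> Poly_Mapping.keys y"
  unfolding tens_def by (intro keys_lext_subset) auto

lemma low2_tens: "x \<in> low n \<Longrightarrow> x \<star> y \<in> low2 n"
  using keys_tens[of x y] by (fastforce simp: low_def low2_def)

lemma low2_tmap:
  assumes "w \<in> low2 n" "\<And>x. x \<in> low n \<Longrightarrow> f x \<in> low m"
  shows "tmap f g w \<in> low2 m"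
proof -
  have "Poly_Mapping.keys (tmap f g w) \<subseteq> {i. pbw_deg (fst i) < m}"
    unfolding tmap_def blift_def
  proof (rule keys_lext_subset)
    fix i assume i: "i \<in> Poly_Mapping.keys w"
    then have "f (bas (fst i)) \<star> g (bas (snd i)) \<in> low2 m"
      using assms by (intro low2_tens assms(2)) (auto simp: low2_def)
    then show "Poly_Mapping.keys (case i of (i, j) \<Rightarrow> f (bas i) \<star> g (bas j)) \<subseteq> {i. pbw_deg (fst i) < m}"
      by (auto simp: low2_def split: prod.split)
  qed
  then show ?thesis by (auto simp: low2_def)
qed

text \<open>
  Only \<open>p \<otimes> 1\<close> contributes to the top degree of the left factor: this gives connectedness, since
  contracting with the dual of a leading monomial then produces a scalar.
\<close>

definition comult_leading :: "nat \<Rightarrow> 'k::field_char_0 pbw \<Rightarrow> bool" where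
  "comult_leading n p \<longleftrightarrow> p \<in> low (Suc n) \<and> comult p - p \<star> pbw_one \<in> low2 n"

lemma comult_leading_low2: "comult_leading n p \<Longrightarrow> comult p \<in> low2 (Suc n)"
  using low2_add[OF low2_mono[of "comult p - p \<star> pbw_one" n "Suc n"] low2_tens[of p "Suc n" pbw_one]]
  by (simp add: comult_leading_def)

lemma comult_leading_X: assumes "comult_leading n p" shows "comult_leading (Suc n) (LX p)"
proof -
  have eq: "comult (LX p) - LX p \<star> pbw_one =
      tmap LX (\<lambda>x. x) (comult p - p \<star> pbw_one) + tmap (\<lambda>x. x) LX (comult p)"
    by (simp add: DX_def tmap_tens lin_simps[OF lin_tmap])
  show ?thesis
    using assms low_L unfolding comult_leading_def eq
    by (auto intro!: low2_add low2_tmap[of _ n LX] low2_tmap[of _ "Suc n" "\<lambda>x. x"]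
        comult_leading_low2[OF assms])
qed

lemma comult_leading_Y: assumes "comult_leading n p" shows "comult_leading (Suc n) (LY p)"
proof -
  have eq: "comult (LY p) - LY p \<star> pbw_one =
      tmap LY (\<lambda>x. x) (comult p - p \<star> pbw_one) + tmap (\<lambda>x. x) LY (comult p)"
    by (simp add: DY_def tmap_tens lin_simps[OF lin_tmap])
  show ?thesis
    using assms low_L unfolding comult_leading_def eq
    by (auto intro!: low2_add low2_tmap[of _ n LY] low2_tmap[of _ "Suc n" "\<lambda>x. x"]
        comult_leading_low2[OF assms])
qed

text \<open>The tight term is X tensor Y: it lifts left degree n to n + 1, still below the new
  leading degree n + 2.\<close>

lemma comult_leading_Z: assumes "comult_leading n p" shows "comult_leading (Suc (Suc n)) (LZ p)"
proof -
  have eq: "comult (LZ p) - LZ p \<star> pbw_one =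
      tmap LZ (\<lambda>x. x) (comult p - p \<star> pbw_one) + tmap (\<lambda>x. x) LZ (comult p) + tmap LX LY (comult p)"
    by (simp add: DZ_def tmap_tens lin_simps[OF lin_tmap])
  show ?thesis
    using assms low_L unfolding comult_leading_def eq
    by (auto intro!: low2_add low2_tmap[of _ n LZ] low2_tmap[of _ "Suc n" LX]
        low2_tmap[of _ "Suc n" "\<lambda>x. x"] comult_leading_low2[OF assms] intro: low_mono)
qed

lemma comult_leading_bas: "comult_leading (pbw_deg i) (bas i :: 'k::field_char_0 pbw)"
proof -
  obtain b c a where i: "i = (b, c, a)" by (metis prod_cases3)
  have "comult_leading 0 (pbw_one :: 'k pbw)"
    by (simp add: comult_leading_def) (simp add: pbw_one_def)
  then have "comult_leading a ((LX ^^ a) (pbw_one :: 'k pbw))"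
    by (induction a) (simp_all add: comult_leading_X)
  then have "comult_leading (2 * c + a) ((LZ ^^ c) ((LX ^^ a) (pbw_one :: 'k pbw)))"
    by (induction c) (simp_all add: comult_leading_Z)
  then have "comult_leading (b + 2 * c + a) ((LY ^^ b) ((LZ ^^ c) ((LX ^^ a) (pbw_one :: 'k pbw))))"
    by (induction b) (simp_all add: comult_leading_Y)
  then show ?thesis by (simp add: i bas_eq_L)
qed

lemma low2_sum: "(\<And>x. x \<in> A \<Longrightarrow> f x \<in> low2 n) \<Longrightarrow> (\<Sum>x\<in>A. f x) \<in> low2 n"
  by (induction A rule: infinite_finite_induct) (auto intro: low2_add)

lemma comult_leading_low:
  assumes "p \<in> low (Suc n)" shows "comult p - p \<star> pbw_one \<in> low2 n"
proof -
  have "lin (\<lambda>p. comult p - p \<star> pbw_one)"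
    by (simp add: lin_def tens_simps scl_diff_right)
  then have "comult p - p \<star> pbw_one = lext (\<lambda>i. comult (bas i) - bas i \<star> pbw_one) p"
    by (rule lin_eq_lext)
  also have "\<dots> \<in> low2 n"
    unfolding lext_def
  proof (intro low2_sum low2_scl)
    fix i assume "i \<in> Poly_Mapping.keys p"
    then have "pbw_deg i \<le> n" using assms by (auto simp: low_def)
    then show "comult (bas i) - bas i \<star> pbw_one \<in> low2 n"
      using comult_leading_bas[of i] low2_mono by (auto simp: comult_leading_def)
  qed
  finally show ?thesis .
qed

text \<open>Contraction of the left tensor factor with the dual basis vector of
  \<open>m\<close>.\<close>

definition slice :: "'i \<Rightarrow> ('i \<times> 'j \<Rightarrow>\<^sub>0 'k::field) \<Rightarrow> ('j \<Rightarrow>\<^sub>0 'k)" where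
  "slice m = blift (\<lambda>x y. Poly_Mapping.lookup x m \<bullet> y)"

lemma lin_slice [intro, simp]: "lin (slice m)"
  by (simp add: slice_def)

lemma slice_tens: "slice m (x \<star> y) = Poly_Mapping.lookup x m \<bullet> y"
  unfolding slice_def
  by (rule blift_tens) (simp add: bilin_def lin_def lookup_add scl_add_left scl_add_right mult.commute)

lemma slice_low2:
  assumes "w \<in> low2 n" "n \<le> pbw_deg m"
  shows "slice m w = 0"
  unfolding slice_def blift_def lext_def
proof (rule sum.neutral, rule ballI)
  fix z assume z: "z \<in> Poly_Mapping.keys w"
  have "fst z \<noteq> m" using assms z by (auto simp: low2_def)
  then show "Poly_Mapping.lookup w z \<bullet> (case z of (i, j) \<Rightarrow> Poly_Mapping.lookup (bas i) m \<bullet> bas j) = 0"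
    by (cases z) (simp add: lookup_single_not_eq)
qed

lemma bas_nonzero: "bas i \<noteq> 0"
  by (metis lookup_single_eq lookup_zero zero_neq_one)

text \<open>Contracting with a monomial of top degree in h annihilates all of the comultiplication
  except h tensor 1, which leaves a nonzero multiple of 1. The contraction maps C tensor C into
  C.\<close>

lemma one_in_subcoalgebra:
  assumes C: "subcoalgebra hopf_B hcomult C" and h: "h \<in> C" "h \<noteq> 0"
  shows "hvec pbw_one \<in> C"
proof -
  define q where "q = hcoord h"
  have "hvec q \<noteq> 0" using h by (simp add: q_def)
  then have "q \<noteq> 0" by auto
  then have K: "Poly_Mapping.keys q \<noteq> {}" by (simp add: keys_eq_empty)
  define n where "n = Max (pbw_deg ` Poly_Mapping.keys q)"
  have "n \<in> pbw_deg ` Poly_Mapping.keys q" unfolding n_def using K by (intro Max_in) auto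
  then obtain m where m: "m \<in> Poly_Mapping.keys q" "pbw_deg m = n" by auto
  have "q \<in> low (Suc n)" by (auto simp: low_def n_def less_Suc_eq_le)
  from slice_low2[OF comult_leading_low[OF this], of m] m(2)
  have slice: "slice m (comult q) = Poly_Mapping.lookup q m \<bullet> pbw_one"
    by (simp add: lin_simps[OF lin_slice] slice_tens)
  have "subspace_of C hopf_B" using C by (simp add: subcoalgebra_def)
  from subspace_ofD[OF this] have sub: "0 \<in> C" "\<And>x y. x \<in> C \<Longrightarrow> y \<in> C \<Longrightarrow> x + y \<in> C"
    "\<And>c x. x \<in> C \<Longrightarrow> c \<bullet> x \<in> C" by simp_all
  interpret T: coord "tensor hopf_B hopf_B" "tcoord hcoord hcoord" by (rule HH.coord_tensor)
  let ?N = "{t \<in> carrier (tensor hopf_B hopf_B). hvec (slice m (tcoord hcoord hcoord t)) \<in> C}"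
  have "tensor_sub hopf_B hopf_B C C \<subseteq> ?N"
    unfolding tensor_sub_def
  proof (rule lin_span_minimal)
    show "subspace_of ?N (tensor hopf_B hopf_B)"
      using sub
      by (intro subspace_ofI coord.module[OF HH.coord_tensor]) (auto simp: lin_simps[OF lin_slice])
    show "{pure_tensor hopf_B hopf_B v w |v w. v \<in> C \<and> w \<in> C} \<subseteq> ?N"
      using sub by (auto simp: HH.tcoord_pure_tensor slice_tens)
  qed
  then have "hcomult h \<in> ?N" using C h unfolding subcoalgebra_def by blast
  then have "Poly_Mapping.lookup q m \<bullet> hvec pbw_one \<in> C"
    by (simp add: slice flip: q_def)
  then have "inverse (Poly_Mapping.lookup q m) \<bullet> Poly_Mapping.lookup q m \<bullet> hvec pbw_one \<in> C"
    by (rule sub(3))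
  then show ?thesis using m(1) by (simp add: in_keys_iff)
qed

text \<open>The scalars form a subcoalgebra contained in every nonzero one, hence they are the
  unique simple subcoalgebra.\<close>

lemma hopf_B_connected: "connected_hopf (hopf_B :: ('k::field_char_0, _) module) hcomult"
proof -
  let ?H = "hopf_B :: ('k, _) module"
  define K :: "(nat list \<Rightarrow>\<^sub>0 'k) set" where "K = {c \<odot>\<^bsub>?H\<^esub> \<one>\<^bsub>?H\<^esub> | c. True}"
  have K: "K = range (\<lambda>c. c \<bullet> hvec pbw_one)" by (auto simp: K_def)
  have one: "hvec pbw_one \<in> K" unfolding K by (rule range_eqI[of _ _ 1]) simp
  have ne: "hvec pbw_one \<noteq> (0 :: nat list \<Rightarrow>\<^sub>0 'k)"
  proof
    assume "hvec pbw_one = (0 :: nat list \<Rightarrow>\<^sub>0 'k)"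
    then have "hcoord (hvec pbw_one) = (0 :: 'k pbw)" by simp
    then show False by (simp add: pbw_one_def bas_nonzero)
  qed
  have sub: "subspace_of K ?H"
  proof (rule subspace_ofI[OF H.module])
    show "\<zero>\<^bsub>?H\<^esub> \<in> K" unfolding K by (auto intro: range_eqI[of _ _ 0])
    show "x \<oplus>\<^bsub>?H\<^esub> y \<in> K" if "x \<in> K" "y \<in> K" for x y
      using that unfolding K by (auto simp flip: scl_add_left)
    show "c \<odot>\<^bsub>?H\<^esub> x \<in> K" if "x \<in> K" for c x
      using that unfolding K by auto
  qed auto
  have coalg: "subcoalgebra ?H hcomult K"
    unfolding subcoalgebra_def
  proof (intro conjI sub image_subsetI)
    fix x assume "x \<in> K"
    then obtain c where x: "x = c \<odot>\<^bsub>?H\<^esub> hvec pbw_one" by (auto simp: K)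
    have "subspace_of (tensor_sub ?H ?H K K) (tensor ?H ?H)"
      unfolding tensor_sub_def
      by (intro subspace_of_lin_span coord.module[OF HH.coord_tensor]) (auto simp: HH.tcoord_pure_tensor)
    moreover have "pure_tensor ?H ?H (hvec pbw_one) (hvec pbw_one) \<in> tensor_sub ?H ?H K K"
      unfolding tensor_sub_def using one by (intro lin_span_incl) blast
    moreover have "hcomult x = c \<odot>\<^bsub>tensor ?H ?H\<^esub> pure_tensor ?H ?H (hvec pbw_one) (hvec pbw_one)"
      by (simp add: x hcomult_def HH.pure_tensor_eq HH.smult_tensor)
    ultimately show "hcomult x \<in> tensor_sub ?H ?H K K"
      by (simp add: subspace_ofD(4))
  qed
  have K_least: "K \<subseteq> C" if C: "subcoalgebra ?H hcomult C" "C \<noteq> {0}" for C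
  proof -
    have Csub: "subspace_of C ?H" using C by (simp add: subcoalgebra_def)
    have "0 \<in> C" using subspace_ofD(2)[OF Csub] by simp
    then obtain h where "h \<in> C" "h \<noteq> 0" using C(2) by auto
    then have "hvec pbw_one \<in> C" by (rule one_in_subcoalgebra[OF C(1)])
    then show ?thesis using subspace_ofD(4)[OF Csub] by (auto simp: K)
  qed
  have K0: "K \<noteq> {0}" using one ne by auto
  have "simple_subcoalgebra ?H hcomult C \<longleftrightarrow> C = K" for C
  proof
    assume C: "simple_subcoalgebra ?H hcomult C"
    then have "K \<subseteq> C" by (intro K_least) (auto simp: simple_subcoalgebra_def)
    then show "C = K" using C coalg K0 by (auto simp: simple_subcoalgebra_def)
  next
    assume "C = K"
    then show "simple_subcoalgebra ?H hcomult C"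
      using coalg K0 K_least unfolding simple_subcoalgebra_def by (metis subset_antisym hopf_B_simps(4))
  qed
  then have "coradical ?H hcomult = lin_span ?H K"
    by (simp add: coradical_def)
  also have "\<dots> = K"
    using lin_span_minimal[OF sub, of K] lin_span_incl[of _ K ?H] by auto
  finally show ?thesis by (simp add: connected_hopf_def K_def)
qed

section \<open>Gelfand--Kirillov dimension\<close>

lemma subspace_of_hopf_B: "subspace_of V hopf_B \<longleftrightarrow> pm.subspace V"
proof
  assume "subspace_of V hopf_B"
  from subspace_ofD[OF this] show "pm.subspace V" by (auto simp: pm.subspace_def)
next
  assume "pm.subspace V"
  then show "subspace_of V hopf_B"
    by (intro subspace_ofI[OF H.module]) (auto simp: pm.subspace_def)
qed

lemma lin_span_hopf_B: "lin_span hopf_B S = pm.span S"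
proof
  show "lin_span hopf_B S \<subseteq> pm.span S"
    by (rule lin_span_minimal) (auto simp: subspace_of_hopf_B pm.span_base)
  show "pm.span S \<subseteq> lin_span hopf_B S"
    by (auto simp: lin_span_def subspace_of_hopf_B dest: pm.span_minimal)
qed

text \<open>Both dimensions are cardinalities of a basis picked by \<open>SOME\<close> from the same
  set, so they coincide once that set is nonempty.\<close>

lemma vdim_hopf_B: "vdim hopf_B (pm.span S) = pm.dim S"
proof -
  have "lin_indep hopf_B B \<longleftrightarrow> pm.independent B" for B :: "(nat list \<Rightarrow>\<^sub>0 'k::field_char_0) set"
    by (auto simp: lin_indep_def lin_span_hopf_B pm.dependent_def)
  moreover obtain B where "B \<subseteq> S" "pm.independent B" "S \<subseteq> pm.span B"
    by (rule pm.basis_exists)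
  then have "pm.independent B \<and> pm.span B = pm.span S"
    by (simp add: pm.span_mono pm.span_minimal antisym)
  ultimately show ?thesis
    unfolding vdim_def pm.dim_def lin_span_hopf_B by auto
qed

section \<open>The degree filtration as an upper bound for growth\<close>

definition hlow :: "nat \<Rightarrow> (nat list \<Rightarrow>\<^sub>0 'k::field_char_0) set" where
  "hlow n = {h. hcoord h \<in> low (Suc n)}"

lemma subspace_hlow: "pm.subspace (hlow n)"
  by (auto simp: pm.subspace_def hlow_def low_add low_scl)

lemma funpow_low:
  fixes f :: "'k::field_char_0 pbw \<Rightarrow> 'k pbw"
  assumes "\<And>n p. p \<in> low n \<Longrightarrow> f p \<in> low (n + d)" "p \<in> low n"
  shows "(f ^^ k) p \<in> low (n + d * k)"
proof (induction k)
  case (Suc k)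
  from assms(1)[OF this] show ?case by (simp add: add_ac)
qed (use assms in simp)

text \<open>Multiplying by a monomial applies each generator as often as its exponent says, and
  every application raises the degree by at most the weight of that generator.\<close>

lemma pbw_mult_low:
  assumes "p \<in> low (Suc n)" "q \<in> low (Suc m)"
  shows "pbw_mult p q \<in> low (Suc (n + m))"
proof -
  have "pbw_mult p q = lext (\<lambda>i. pbw_mult (bas i) q) p"
    by (rule lin_eq_lext[OF L.lin_act])
  also have "\<dots> \<in> low (Suc (n + m))"
  proof (rule low_lext[OF assms(1)])
    fix i assume i: "pbw_deg i < Suc n"
    obtain b c a where bca: "i = (b, c, a)" by (metis prod_cases3)
    \<comment> \<open>The form \<open>1 * a\<close> is kept so that the bound unifies with
      \<open>d * k\<close> in \<open>funpow_low\<close>.\<close>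
    have "(LX ^^ a) q \<in> low (Suc m + 1 * a)"
      by (rule funpow_low) (simp_all add: low_L assms)
    then have "(LZ ^^ c) ((LX ^^ a) q) \<in> low (Suc m + 1 * a + 2 * c)"
      by (rule funpow_low[rotated]) (simp_all add: low_L)
    then have "(LY ^^ b) ((LZ ^^ c) ((LX ^^ a) q)) \<in> low (Suc m + 1 * a + 2 * c + 1 * b)"
      by (rule funpow_low[rotated]) (simp_all add: low_L)
    then show "pbw_mult (bas i) q \<in> low (Suc (n + m))"
      unfolding bca L.act_bas using i bca by (elim low_mono) auto
  qed
  finally show ?thesis .
qed

lemma hlow_mult: "x \<in> hlow n \<Longrightarrow> y \<in> hlow m \<Longrightarrow> x \<otimes>\<^bsub>hopf_B\<^esub> y \<in> hlow (n + m)"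
  by (simp add: hlow_def pbw_mult_low)

lemma hlow_mono: "n \<le> m \<Longrightarrow> hlow n \<subseteq> hlow m"
  by (auto simp: hlow_def elim: low_mono)

lemma hlow_exhaust: "\<exists>d. h \<in> hlow d"
proof -
  have "h \<in> hlow (Max (insert 0 (pbw_deg ` Poly_Mapping.keys (hcoord h))))"
    by (auto simp: hlow_def low_def less_Suc_eq_le)
  then show ?thesis ..
qed

lemma finite_hlow_exhaust:
  assumes "finite B" shows "\<exists>d. B \<subseteq> hlow d"
  using assms
proof (induction B rule: finite_induct)
  case (insert h B)
  then obtain d d' where "B \<subseteq> hlow d" "h \<in> hlow d'" using hlow_exhaust by blast
  then have "insert h B \<subseteq> hlow (max d d')"
    using hlow_mono[of d "max d d'"] hlow_mono[of d' "max d d'"] by auto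
  then show ?case ..
qed auto

lemma subspace_power_hlow:
  assumes "V \<subseteq> hlow d"
  shows "subspace_power hopf_B V i \<subseteq> hlow (d * i)"
proof (induction i)
  case 0
  show ?case
    unfolding subspace_power.simps lin_span_hopf_B
    by (rule pm.span_minimal[OF _ subspace_hlow]) (simp add: hlow_def pbw_one_def)
next
  case (Suc i)
  show ?case
    unfolding subspace_power.simps lin_span_hopf_B
    using hlow_mult[of _ "d * i" _ d] assms Suc
    by (intro pm.span_minimal subspace_hlow) (auto simp: add.commute simp del: hopf_B_simps)
qed

text \<open>A box of exponents instead of all monomials of degree at most n: it is easier to count
  and has the same cubic growth.\<close>

definition mons :: "nat \<Rightarrow> (nat list \<Rightarrow>\<^sub>0 'k::field_char_0) set" where
  "mons n = (\<lambda>i. hvec (bas i)) ` ({..n} \<times> {..n} \<times> {..n})"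

lemma inj_hvec_bas: "inj (\<lambda>i. hvec (bas i))"
proof (rule injI)
  fix i j :: "nat \<times> nat \<times> nat"
  assume "hvec (bas i) = (hvec (bas j) :: nat list \<Rightarrow>\<^sub>0 'a)"
  then have "hcoord (hvec (bas i)) = (hcoord (hvec (bas j)) :: _ \<Rightarrow>\<^sub>0 'a)" by simp
  then have "Poly_Mapping.lookup (bas i :: _ \<Rightarrow>\<^sub>0 'a) i = Poly_Mapping.lookup (bas j :: _ \<Rightarrow>\<^sub>0 'a) i" by simp
  then show "i = j" by (simp add: lookup_single when_def split: if_splits)
qed

lemma card_mons: "card (mons n :: (nat list \<Rightarrow>\<^sub>0 'k::field_char_0) set) = (n + 1) ^ 3"
proof -
  have "inj_on (\<lambda>i. hvec (bas i) :: nat list \<Rightarrow>\<^sub>0 'k) ({..n} \<times> {..n} \<times> {..n})"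
    by (rule inj_on_subset[OF inj_hvec_bas]) auto
  then show ?thesis
    unfolding mons_def by (simp add: card_image card_cartesian_product power3_eq_cube)
qed

lemma finite_mons: "finite (mons n)"
  by (simp add: mons_def)

lemma hlow_subset_span_mons: "hlow n \<subseteq> pm.span (mons n)"
proof
  fix h :: "nat list \<Rightarrow>\<^sub>0 'k::field_char_0" assume h: "h \<in> hlow n"
  have "h = hvec (lext bas (hcoord h))" by (simp add: lext_of_bas)
  also have "\<dots> = lext (\<lambda>i. hvec (bas i)) (hcoord h)"
    by (rule lin_lext_commute[OF lin_hvec])
  also have "\<dots> \<in> pm.span (mons n)"
    unfolding lext_def
  proof (intro pm.span_sum pm.span_scale pm.span_base)
    fix i assume "i \<in> Poly_Mapping.keys (hcoord h)"
    then have "pbw_deg i \<le> n" using h by (auto simp: hlow_def low_def)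
    then show "hvec (bas i) \<in> mons n"
      unfolding mons_def by (cases i) auto
  qed
  finally show "h \<in> pm.span (mons n)" .
qed

lemma independent_mons: "pm.independent (mons n)"
  unfolding pm.dependent_def
proof safe
  fix h :: "nat list \<Rightarrow>\<^sub>0 'k::field_char_0"
  assume h: "h \<in> mons n" "h \<in> pm.span (mons n - {h})"
  then obtain i where i: "h = hvec (bas i)" by (auto simp: mons_def)
  have "pm.subspace {x :: nat list \<Rightarrow>\<^sub>0 'k. Poly_Mapping.lookup (hcoord x) i = 0}"
    by (auto simp: pm.subspace_def lookup_add)
  moreover have "mons n - {h} \<subseteq> {x. Poly_Mapping.lookup (hcoord x) i = 0}"
    by (auto simp: mons_def i lookup_single when_def)
  ultimately have "h \<in> {x. Poly_Mapping.lookup (hcoord x) i = 0}"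
    using h(2) pm.span_minimal by blast
  then show False by (simp add: i)
qed

text \<open>Extend \<open>B\<close> to a basis of \<open>S\<close>. The finite set \<open>W\<close>
  keeps that basis finite; an infinite one would have \<open>card\<close> equal to 0.\<close>

lemma card_le_dim:
  fixes B :: "('i \<Rightarrow>\<^sub>0 'k::field) set"
  assumes "pm.independent B" "B \<subseteq> S" "S \<subseteq> pm.span W" "finite W"
  shows "card B \<le> pm.dim S"
proof -
  obtain B' where B': "B \<subseteq> B'" "B' \<subseteq> S" "pm.independent B'" "S \<subseteq> pm.span B'"
    using pm.maximal_independent_subset_extend[OF assms(2,1)] by blast
  have "finite B'"
    using pm.independent_span_bound[OF assms(4) B'(3)] B'(2) assms(3) by blast
  then have "card B \<le> card B'" using B'(1) by (rule card_mono)
  also have "card B' = pm.dim S" using B' by (intro pm.basis_card_eq_dim)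
  finally show ?thesis .
qed

section \<open>Monomials in powers of the generating subspace\<close>

definition gens :: "(nat list \<Rightarrow>\<^sub>0 'k::field_char_0) set" where
  "gens = pm.span (hvec ` {LX pbw_one, LY pbw_one, LZ pbw_one})"

lemma hvec_gen: "hvec (LX pbw_one) \<in> gens" "hvec (LY pbw_one) \<in> gens" "hvec (LZ pbw_one) \<in> gens"
  unfolding gens_def by (auto intro: pm.span_base)

lemma power_gens_step:
  assumes "hvec p \<in> subspace_power hopf_B gens n" "hvec q \<in> gens"
  shows "hvec (pbw_mult p q) \<in> subspace_power hopf_B gens (Suc n)"
proof -
  have "hvec (pbw_mult p q) = hvec p \<otimes>\<^bsub>hopf_B\<^esub> hvec q" by simp
  then show ?thesis
    unfolding subspace_power.simps using assms by (intro lin_span_incl) blast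
qed

text \<open>\<open>subspace_power\<close> multiplies on the right, so a monomial is built from left
  to right, Y first and X last, and no generator has to be commuted.\<close>

lemma pbw_mult_bas_gen:
  "pbw_mult (bas (b, 0, 0)) (LY pbw_one) = bas (Suc b, 0, 0)"
  "pbw_mult (bas (b, c, 0)) (LZ pbw_one) = bas (b, Suc c, 0)"
  "pbw_mult (bas (b, c, a)) (LX pbw_one) = bas (b, c, Suc a)"
  unfolding L.act_bas by (simp_all add: bas_eq_L funpow_swap1)

lemma mon_in_power_gens: "hvec (bas (b, c, a)) \<in> subspace_power hopf_B gens (b + c + a)"
proof -
  have Y: "hvec (bas (b, 0, 0)) \<in> subspace_power hopf_B gens b"
  proof (induction b)
    case 0
    show ?case by (auto simp: pbw_one_def intro: lin_span_incl)
  next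
    case (Suc b)
    from power_gens_step[OF Suc hvec_gen(2)] show ?case
      by (simp add: pbw_mult_bas_gen del: subspace_power.simps)
  qed
  have Z: "hvec (bas (b, c, 0)) \<in> subspace_power hopf_B gens (b + c)"
  proof (induction c)
    case (Suc c)
    from power_gens_step[OF Suc hvec_gen(3)] show ?case
      by (simp add: pbw_mult_bas_gen del: subspace_power.simps)
  qed (use Y in simp)
  show ?thesis
  proof (induction a)
    case (Suc a)
    from power_gens_step[OF Suc hvec_gen(1)] show ?case
      by (simp add: pbw_mult_bas_gen del: subspace_power.simps)
  qed (use Z in simp)
qed

text \<open>The logarithm equals 3 + 3 ln c / ln n for n > 1, so the factor c disappears in the
  limit. It absorbs the crude constants of both growth bounds.\<close>

lemma tendsto_log_cube:
  fixes c :: real assumes "c > 0"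
  shows "(\<lambda>n. log (real n) ((c * real n) ^ 3)) \<longlonglongrightarrow> 3"
proof -
  have "filterlim (\<lambda>n. ln (real n)) at_top sequentially"
    by (rule filterlim_compose[OF ln_at_top filterlim_real_sequentially])
  then have "(\<lambda>n. ln c / ln (real n)) \<longlonglongrightarrow> 0"
    by (rule real_tendsto_divide_at_top[OF tendsto_const])
  then have "(\<lambda>n. 3 * (ln c / ln (real n)) + 3) \<longlonglongrightarrow> 3 * 0 + 3"
    by (intro tendsto_intros)
  moreover have "eventually (\<lambda>n. 3 * (ln c / ln (real n)) + 3 = log (real n) ((c * real n) ^ 3)) sequentially"
    using eventually_gt_at_top[of 1]
  proof eventually_elim
    case (elim n)
    then have "ln (real n) > 0" by simp
    moreover have "ln ((c * real n) ^ 3) = 3 * (ln c + ln (real n))"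
      using elim assms by (simp add: ln_realpow ln_mult_pos)
    ultimately show ?case
      by (simp add: log_def add_divide_distrib distrib_left)
  qed
  ultimately show ?thesis by (simp add: tendsto_cong)
qed

lemma GKdim_hopf_B: "GKdim (hopf_B :: ('k::field_char_0, _) module) = 3"
proof -
  let ?H = "hopf_B :: ('k, _) module"
  let ?S = "\<lambda>V n. \<Union>i\<le>n. subspace_power ?H V i"
  let ?f = "\<lambda>V n. ereal (log (real n) (real (pm.dim (?S V n))))"
  have lim: "limsup (\<lambda>n. ereal (log (real n) ((c * real n) ^ 3))) = 3" if "c > 0" for c :: real
    using lim_imp_Limsup[OF _ tendsto_ereal[OF tendsto_log_cube[OF that]]] by simp
  have upper: "limsup (?f V) \<le> 3" if V: "fin_dim ?H V" for V
  proof -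
    obtain B where B: "finite B" "V = pm.span B"
      using V by (auto simp: fin_dim_def lin_span_hopf_B)
    obtain d where "B \<subseteq> hlow d" using finite_hlow_exhaust[OF B(1)] by blast
    then have Vd: "V \<subseteq> hlow d" unfolding B(2) by (intro pm.span_minimal subspace_hlow)
    have bound: "pm.dim (?S V n) \<le> (d * n + 1) ^ 3" for n
    proof -
      have "?S V n \<subseteq> hlow (d * n)"
        using subspace_power_hlow[OF Vd] hlow_mono[of "d * i" "d * n" for i] by fastforce
      then have "pm.dim (?S V n) \<le> card (mons (d * n) :: (nat list \<Rightarrow>\<^sub>0 'k) set)"
        using hlow_subset_span_mons by (intro pm.dim_le_card finite_mons) blast
      then show ?thesis by (simp add: card_mons)
    qed
    have "limsup (?f V) \<le> limsup (\<lambda>n. ereal (log (real n) (((real d + 1) * real n) ^ 3)))"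
    proof (rule Limsup_mono)
      show "eventually (\<lambda>n. ?f V n \<le> ereal (log (real n) (((real d + 1) * real n) ^ 3))) sequentially"
        using eventually_gt_at_top[of 1]
      proof eventually_elim
        case (elim n)
        let ?b = "((real d + 1) * real n) ^ 3"
        have "real (pm.dim (?S V n)) \<le> real ((d * n + 1) ^ 3)"
          using bound[of n] by (simp only: of_nat_le_iff)
        also have "\<dots> \<le> ?b"
          using elim by (simp add: algebra_simps power_mono)
        finally have b: "real (pm.dim (?S V n)) \<le> ?b" .
        have "1 * 1 \<le> (real d + 1) * real n" using elim by (intro mult_mono) auto
        then have 1: "1 \<le> ?b" by (intro one_le_power) simp
        show ?case
        proof (cases "pm.dim (?S V n) = 0")
          case True
          \<comment> \<open>Monotonicity of \<open>log\<close> needs a positive argument. For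
            dimension 0 the convention \<open>ln 0 = 0\<close> makes the left side 0, and
            \<open>1 \<le> ?b\<close> makes the right side nonnegative.\<close>
          then show ?thesis using 1 elim by (simp add: log_def)
        next
          case False
          then show ?thesis using b elim by (simp add: log_mono)
        qed
      qed
    qed
    also have "\<dots> = 3" by (rule lim) simp
    finally show ?thesis .
  qed
  have fin: "fin_dim ?H gens"
    unfolding fin_dim_def lin_span_hopf_B gens_def
    by (intro exI[of _ "hvec ` {LX pbw_one, LY pbw_one, LZ pbw_one}"]) auto
  have lower: "3 \<le> limsup (?f gens)"
  proof -
    \<comment> \<open>This inclusion supplies the finite spanning set that
      \<open>card_le_dim\<close> asks for.\<close>
    obtain d where d: "hvec ` {LX pbw_one, LY pbw_one, LZ pbw_one} \<subseteq> (hlow d :: (_ \<Rightarrow>\<^sub>0 'k) set)"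
      using finite_hlow_exhaust[of "hvec ` {LX pbw_one, LY pbw_one, LZ pbw_one}"] by auto
    then have gd: "(gens :: (_ \<Rightarrow>\<^sub>0 'k) set) \<subseteq> hlow d"
      unfolding gens_def by (intro pm.span_minimal subspace_hlow)
    \<comment> \<open>With all three exponents at most n div 3, a monomial is a product of at most n
      generators.\<close>
    have bound: "(n div 3 + 1) ^ 3 \<le> pm.dim (?S gens n)" for n
    proof -
      have "mons (n div 3) \<subseteq> ?S gens n"
      proof
        fix h :: "nat list \<Rightarrow>\<^sub>0 'k" assume "h \<in> mons (n div 3)"
        then obtain b c a where h: "h = hvec (bas (b, c, a))" "b \<le> n div 3" "c \<le> n div 3" "a \<le> n div 3"
          by (auto simp: mons_def)
        then have "b + c + a \<le> n" by linarith
        then show "h \<in> ?S gens n" using mon_in_power_gens[of b c a] h(1) by blast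
      qed
      moreover have "?S gens n \<subseteq> pm.span (mons (d * n))"
        using subspace_power_hlow[OF gd] hlow_mono[of "d * i" "d * n" for i] hlow_subset_span_mons[of "d * n"]
        by fastforce
      ultimately have "card (mons (n div 3) :: (nat list \<Rightarrow>\<^sub>0 'k) set) \<le> pm.dim (?S gens n)"
        by (rule card_le_dim[OF independent_mons _ _ finite_mons])
      then show ?thesis by (simp add: card_mons)
    qed
    have "3 = limsup (\<lambda>n. ereal (log (real n) ((1 / 3 * real n) ^ 3)))" by (rule lim[symmetric]) simp
    also have "\<dots> \<le> limsup (?f gens)"
    proof (rule Limsup_mono)
      show "eventually (\<lambda>n. ereal (log (real n) ((1 / 3 * real n) ^ 3)) \<le> ?f gens n) sequentially"
        using eventually_gt_at_top[of 1]
      proof eventually_elim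
        case (elim n)
        have "1 / 3 * real n \<le> real (n div 3 + 1)" by linarith
        then have "(1 / 3 * real n) ^ 3 \<le> real (n div 3 + 1) ^ 3" by (rule power_mono) simp
        also have "\<dots> \<le> real (pm.dim (?S gens n))"
          using bound[of n] by (simp only: of_nat_power[symmetric] of_nat_le_iff)
        finally show ?case using elim by (simp add: log_mono)
      qed
    qed
    finally show ?thesis .
  qed
  have "GKdim ?H = (SUP V \<in> {V. fin_dim ?H V}. limsup (?f V))"
    by (simp add: GKdim_def lin_span_hopf_B vdim_hopf_B)
  also have "\<dots> = 3"
    using upper lower fin by (intro antisym SUP_least SUP_upper2[of gens]) auto
  finally show ?thesis .
qed

section \<open>The Jordan plane as a coideal subalgebra\<close>

text \<open>The span of the monomials Y^b Z^c. It is stable under \<open>LY\<close> and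
  \<open>LZ\<close>, as commuting Z past Y creates no X.\<close>

definition jcoord :: "'k::field_char_0 pbw set" where
  "jcoord = {p. \<forall>i\<in>Poly_Mapping.keys p. snd (snd i) = 0}"

lemma jcoord_add: "p \<in> jcoord \<Longrightarrow> q \<in> jcoord \<Longrightarrow> p + q \<in> jcoord"
  and jcoord_scl: "p \<in> jcoord \<Longrightarrow> c \<bullet> p \<in> jcoord"
  and jcoord_zero [simp]: "0 \<in> jcoord"
  and jcoord_bas [simp]: "bas i \<in> jcoord \<longleftrightarrow> snd (snd i) = 0"
  and jcoord_uminus: "p \<in> jcoord \<Longrightarrow> - p \<in> jcoord"
  using keys_add[of p q] keys_scl[of c p] by (fastforce simp: jcoord_def keys_uminus)+

lemma jcoord_lext:
  assumes "p \<in> jcoord" "\<And>i. snd (snd i) = 0 \<Longrightarrow> F i \<in> jcoord"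
  shows "lext F p \<in> jcoord"
  using keys_lext_subset[of p F "{i. snd (snd i) = 0}"] assms by (fastforce simp: jcoord_def)

lemma jcoord_one [simp]: "pbw_one \<in> jcoord"
  by (simp add: pbw_one_def)

lemma jcoord_L:
  assumes "p \<in> jcoord" shows "LY p \<in> jcoord" "LZ p \<in> jcoord"
  using assms unfolding LY_def LZ_def
  by (auto intro!: jcoord_lext jcoord_add jcoord_scl split: prod.split)

lemma jcoord_induct [consumes 1, case_names one add scale Y Z]:
  fixes p :: "'k::field_char_0 pbw"
  assumes "p \<in> jcoord" "P pbw_one"
    and "\<And>p q. P p \<Longrightarrow> P q \<Longrightarrow> P (p + q)" "\<And>c p. P p \<Longrightarrow> P (c \<bullet> p)"
    and "\<And>p. p \<in> jcoord \<Longrightarrow> P p \<Longrightarrow> P (LY p)" "\<And>p. p \<in> jcoord \<Longrightarrow> P p \<Longrightarrow> P (LZ p)"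
  shows "P p"
proof -
  have Z: "P ((LZ ^^ c) (pbw_one :: 'k pbw)) \<and> (LZ ^^ c) (pbw_one :: 'k pbw) \<in> jcoord" for c
    by (induction c) (simp_all add: assms(2,6) jcoord_L)
  have Y: "P ((LY ^^ b) ((LZ ^^ c) (pbw_one :: 'k pbw))) \<and> (LY ^^ b) ((LZ ^^ c) (pbw_one :: 'k pbw)) \<in> jcoord" for b c
    by (induction b) (simp_all add: Z assms(5) jcoord_L)
  have bas: "P (bas (b, c, 0))" for b c
    using Y[of b c] by (simp add: bas_eq_L)
  have zero: "P 0"
    using assms(4)[OF assms(2), of 0] by simp
  have sum: "P (\<Sum>i\<in>A. f i)" if "\<And>i. i \<in> A \<Longrightarrow> P (f i)" for A and f :: "nat \<times> nat \<times> nat \<Rightarrow> 'k pbw"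
    using that by (induction A rule: infinite_finite_induct) (auto intro: assms(3) simp: zero)
  have "P (lext bas p)"
    unfolding lext_def
  proof (intro sum assms(4))
    fix i assume "i \<in> Poly_Mapping.keys p"
    then have "snd (snd i) = 0" using assms(1) by (auto simp: jcoord_def)
    then show "P (bas i)" using bas[of "fst i" "fst (snd i)"] by (metis prod.collapse)
  qed
  then show ?thesis by (simp add: lext_of_bas)
qed

lemma jcoord_mult: "p \<in> jcoord \<Longrightarrow> q \<in> jcoord \<Longrightarrow> pbw_mult p q \<in> jcoord"
  by (induction p rule: jcoord_induct) (auto intro: jcoord_add jcoord_scl jcoord_L)

definition jset :: "(nat list \<Rightarrow>\<^sub>0 'k::field_char_0) set" where
  "jset = {h. hcoord h \<in> jcoord}"

lemma subring_jset: "subring jset hopf_B"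
proof (rule ring.subringI[OF ring_hopf_B])
  fix h :: "nat list \<Rightarrow>\<^sub>0 'k::field_char_0" assume "h \<in> jset"
  moreover have "\<ominus>\<^bsub>hopf_B\<^esub> h = - h"
    using H.minus_equality[of "- h" h] by simp
  ultimately show "\<ominus>\<^bsub>hopf_B\<^esub> h \<in> jset" by (simp add: jset_def jcoord_uminus)
qed (auto simp: jset_def jcoord_mult jcoord_add)

lemma subspace_jset: "subspace_of jset hopf_B"
  by (rule subspace_ofI[OF H.module]) (auto simp: jset_def jcoord_add jcoord_scl)

definition jcoord2 :: "((nat \<times> nat \<times> nat) \<times> nat \<times> nat \<times> nat \<Rightarrow>\<^sub>0 'k::field_char_0) set" where
  "jcoord2 = {w. \<forall>i\<in>Poly_Mapping.keys w. snd (snd (snd i)) = 0}"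

lemma jcoord2_add: "p \<in> jcoord2 \<Longrightarrow> q \<in> jcoord2 \<Longrightarrow> p + q \<in> jcoord2"
  and jcoord2_scl: "p \<in> jcoord2 \<Longrightarrow> c \<bullet> p \<in> jcoord2"
  using keys_add[of p q] keys_scl[of c p] by (fastforce simp: jcoord2_def)+

lemma jcoord2_tens: "y \<in> jcoord \<Longrightarrow> x \<star> y \<in> jcoord2"
  using keys_tens[of x y] by (fastforce simp: jcoord_def jcoord2_def)

lemma jcoord2_tmap:
  assumes "w \<in> jcoord2" "\<And>x. x \<in> jcoord \<Longrightarrow> g x \<in> jcoord"
  shows "tmap f g w \<in> jcoord2"
proof -
  have "Poly_Mapping.keys (tmap f g w) \<subseteq> {i. snd (snd (snd i)) = 0}"
    unfolding tmap_def blift_def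
  proof (rule keys_lext_subset)
    fix i assume i: "i \<in> Poly_Mapping.keys w"
    then have "f (bas (fst i)) \<star> g (bas (snd i)) \<in> jcoord2"
      using assms by (intro jcoord2_tens assms(2)) (auto simp: jcoord2_def)
    then show "Poly_Mapping.keys (case i of (i, j) \<Rightarrow> f (bas i) \<star> g (bas j)) \<subseteq> {i. snd (snd (snd i)) = 0}"
      by (auto simp: jcoord2_def split: prod.split)
  qed
  then show ?thesis by (auto simp: jcoord2_def)
qed

text \<open>In \<open>DY\<close> and \<open>DZ\<close> the operator \<open>LX\<close> acts on left
  factors alone, so right factors stay free of X.\<close>

lemma comult_jcoord: "p \<in> jcoord \<Longrightarrow> comult p \<in> jcoord2"
  by (induction p rule: jcoord_induct)
    (auto intro!: jcoord2_add jcoord2_scl jcoord2_tens jcoord2_tmap simp: jcoord_L DY_def DZ_def)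

lemma coideal_jset: "coideal_subalgebra (hopf_B :: ('k::field_char_0, _) module) hcomult jset"
proof -
  let ?H = "hopf_B :: ('k, _) module"
  let ?N = "tensor_sub ?H ?H (carrier ?H) jset"
  have N: "subspace_of ?N (tensor ?H ?H)"
    unfolding tensor_sub_def
    by (intro subspace_of_lin_span coord.module[OF HH.coord_tensor]) (auto simp: HH.tcoord_pure_tensor)
  have pure: "HH.fib (x \<star> y) \<in> ?N" if "y \<in> jcoord" for x y :: "'k pbw"
  proof -
    have y: "hvec y \<in> jset" using that by (simp add: jset_def)
    have "pure_tensor ?H ?H (hvec x) (hvec y) \<in> ?N"
      unfolding tensor_sub_def using y by (intro lin_span_incl) auto
    then show ?thesis by (simp add: HH.pure_tensor_eq)
  qed
  have sum: "HH.fib (\<Sum>i\<in>A. f i) \<in> ?N" if "\<And>i. i \<in> A \<Longrightarrow> HH.fib (f i) \<in> ?N" for A and f :: "'i \<Rightarrow> _"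
    using that subspace_ofD(2,3)[OF N]
    by (induction A rule: infinite_finite_induct) (auto simp: HH.zero_tensor simp flip: HH.add_tensor)
  have fib: "HH.fib w \<in> ?N" if "w \<in> jcoord2" for w
  proof -
    have "HH.fib (lext bas w) \<in> ?N"
      unfolding lext_def
    proof (rule sum)
      fix i assume "i \<in> Poly_Mapping.keys w"
      then have "HH.fib (bas (fst i) \<star> bas (snd i)) \<in> ?N"
        using that by (intro pure) (auto simp: jcoord2_def)
      then have "HH.fib (bas i) \<in> ?N" by simp
      from subspace_ofD(4)[OF N this] show "HH.fib (Poly_Mapping.lookup w i \<bullet> bas i) \<in> ?N"
        by (simp add: HH.smult_tensor)
    qed
    then show ?thesis by (simp add: lext_of_bas)
  qed
  have "hcomult ` jset \<subseteq> ?N"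
  proof (rule image_subsetI)
    fix h assume "h \<in> (jset :: (nat list \<Rightarrow>\<^sub>0 'k) set)"
    then have "hcoord h \<in> jcoord" by (simp add: jset_def)
    then show "hcomult h \<in> ?N" unfolding hcomult_def by (intro fib comult_jcoord)
  qed
  then show ?thesis
    by (simp add: coideal_subalgebra_def subring_jset subspace_jset)
qed

subsection \<open>The presentation\<close>

lemma free_algebra_simps [simp]:
  "carrier free_algebra = UNIV" "\<zero>\<^bsub>free_algebra\<^esub> = 0" "p \<oplus>\<^bsub>free_algebra\<^esub> q = p + q"
  "c \<odot>\<^bsub>free_algebra\<^esub> p = c \<bullet> p" "\<one>\<^bsub>free_algebra\<^esub> = bas []"
  by (simp_all add: free_algebra_def monoid_algebra_simps)

definition fmult :: "('x list \<Rightarrow>\<^sub>0 'k::field) \<Rightarrow> ('x list \<Rightarrow>\<^sub>0 'k) \<Rightarrow> ('x list \<Rightarrow>\<^sub>0 'k)" where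
  "fmult p q = lext (\<lambda>u. lext (\<lambda>v. bas (u @ v)) q) p"

lemma mult_free_algebra [simp]: "p \<otimes>\<^bsub>free_algebra\<^esub> q = fmult p q"
  by (simp add: free_algebra_def monoid_algebra_mult fmult_def)

lemma bilin_fmult: "bilin fmult"
  unfolding fmult_def by (intro bilinI lin_lext lin_lext_param)

lemma fmult_bas [simp]: "fmult (bas u) (bas v) = bas (u @ v)"
  by (simp add: fmult_def)

lemmas fmult_simps [simp] =
  lin_simps[OF bilin_left[OF bilin_fmult]] lin_simps[OF bilin_right[OF bilin_fmult]]

lemma fmult_assoc: "fmult (fmult p q) r = fmult p (fmult q r)"
proof (induction p rule: poly_mapping_linear_induct)
  case (basis u)
  show ?case
  proof (induction q rule: poly_mapping_linear_induct)
    case (basis v)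
    show ?case by (induction r rule: poly_mapping_linear_induct) simp_all
  qed simp_all
qed simp_all

lemma fmult_one [simp]: "fmult (bas []) p = p" "fmult p (bas []) = p"
  by (induction p rule: poly_mapping_linear_induct; simp)+

lemma module_free_algebra: "module base_field free_algebra"
  unfolding free_algebra_def by (rule module_monoid_algebra)

lemma ring_free_algebra: "ring free_algebra"
proof (rule ringI)
  show "abelian_group free_algebra" by (rule module.axioms(2)[OF module_free_algebra])
  show "Group.monoid free_algebra" by (rule monoidI) (simp_all add: fmult_assoc)
qed simp_all

lemma minus_free_algebra: "p \<ominus>\<^bsub>free_algebra\<^esub> q = p - q"
proof -
  interpret ring free_algebra by (rule ring_free_algebra)
  have "\<ominus>\<^bsub>free_algebra\<^esub> q = - q" using minus_equality[of "- q" q] by simp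
  then show ?thesis by (simp add: a_minus_def)
qed

fun jgen_op :: "jordan_gen \<Rightarrow> 'k::field_char_0 pbw \<Rightarrow> 'k pbw" where
  "jgen_op JX p = 2 \<bullet> LZ p"
| "jgen_op JY p = LY p"

definition jword :: "jordan_gen list \<Rightarrow> 'k::field_char_0 pbw" where
  "jword w = foldr jgen_op w pbw_one"

definition jhom :: "(jordan_gen list \<Rightarrow>\<^sub>0 'k::field_char_0) \<Rightarrow> 'k pbw" where
  "jhom = lext jword"

lemma lin_jhom [simp, intro]: "lin jhom"
  by (simp add: jhom_def)

lemmas jhom_simps [simp] = lin_simps[OF lin_jhom]

lemma jhom_bas [simp]: "jhom (bas w) = jword w"
  by (simp add: jhom_def)

lemma jword_simps [simp]: "jword [] = pbw_one" "jword (g # w) = jgen_op g (jword w)"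
  by (simp_all add: jword_def)

lemma jgen_op_mult: "pbw_mult (jgen_op g p) q = jgen_op g (pbw_mult p q)"
  by (cases g) simp_all

lemma jword_append: "jword (u @ v) = pbw_mult (jword u) (jword v)"
  by (induction u) (simp_all add: jgen_op_mult)

lemma jhom_fmult: "jhom (fmult p q) = pbw_mult (jhom p) (jhom q)"
proof (induction p rule: poly_mapping_linear_induct)
  case (basis u)
  show ?case by (induction q rule: poly_mapping_linear_induct) (simp_all add: jword_append)
qed simp_all

lemma jword_jcoord: "jword w \<in> jcoord"
proof (induction w)
  case (Cons g w)
  then show ?case by (cases g) (simp_all add: jcoord_L jcoord_scl)
qed simp

definition jordan_relator :: "jordan_gen list \<Rightarrow>\<^sub>0 'k::field" where
  "jordan_relator = bas [JX, JY] - bas [JY, JX] - bas [JY, JY]"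

lemma jhom_relator: "jhom (jordan_relator :: _ \<Rightarrow>\<^sub>0 'k::field_char_0) = 0"
proof -
  have "2 \<bullet> (1 / 2) \<bullet> v = v" for v :: "'k pbw" by simp
  then show ?thesis by (simp add: jordan_relator_def L_rels scl_add_right)
qed

text \<open>A section of \<open>jhom\<close> over \<open>jcoord\<close>: Z^c lifts to the c-th power
  of \<open>JX\<close> divided by 2^c. The exponent of X is discarded, so the values are meant for
  elements of \<open>jcoord\<close>.\<close>

definition jsec :: "'k::field_char_0 pbw \<Rightarrow> (jordan_gen list \<Rightarrow>\<^sub>0 'k)" where
  "jsec = lext (\<lambda>(b, c, a). (1 / 2 ^ c) \<bullet> bas (replicate b JY @ replicate c JX))"

lemma lin_jsec [simp, intro]: "lin jsec"
  by (simp add: jsec_def)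

lemmas jsec_simps [simp] = lin_simps[OF lin_jsec]

lemma jsec_bas: "jsec (bas (b, c, a)) = (1 / 2 ^ c) \<bullet> bas (replicate b JY @ replicate c JX)"
  by (simp add: jsec_def)

text \<open>Modulo the ideal each p is congruent to \<open>jsec (jhom p)\<close>, its normal form
  with all \<open>JY\<close> in front. An element of the kernel is therefore congruent to 0.\<close>

lemma jordan_ideal:
  "Idl\<^bsub>free_algebra\<^esub> {jordan_relator} = {p :: jordan_gen list \<Rightarrow>\<^sub>0 'k::field_char_0. jhom p = 0}"
proof
  interpret F: ring "free_algebra :: ('k, jordan_gen list \<Rightarrow>\<^sub>0 'k) module" by (rule ring_free_algebra)
  let ?F = "free_algebra :: ('k, jordan_gen list \<Rightarrow>\<^sub>0 'k) module"
  let ?K = "{p :: jordan_gen list \<Rightarrow>\<^sub>0 'k. jhom p = 0}"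
  have "subspace_of ?K ?F"
    by (rule subspace_ofI[OF module_free_algebra]) auto
  then have "subgroup ?K (add_monoid ?F)" by (rule submodule.axioms(1))
  then have "ideal ?K ?F"
    by (intro idealI ring_free_algebra) (auto simp: jhom_fmult)
  then show "Idl\<^bsub>?F\<^esub> {jordan_relator} \<subseteq> ?K"
    by (rule F.genideal_minimal) (simp add: jhom_relator)
  define I where "I = Idl\<^bsub>?F\<^esub> {jordan_relator}"
  interpret I: ideal I ?F
    unfolding I_def by (rule F.genideal_ideal) simp
  have rel: "jordan_relator \<in> I"
    unfolding I_def by (rule F.genideal_self') simp
  have I_add: "p + q \<in> I" if "p \<in> I" "q \<in> I" for p q
    using I.a_closed[OF that] by simp
  have I_l: "fmult q p \<in> I" and I_r: "fmult p q \<in> I" if "p \<in> I" for p q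
    using I.I_l_closed[OF that, of q] I.I_r_closed[OF that, of q] by simp_all
  have I_scl: "c \<bullet> p \<in> I" if "p \<in> I" for c p
    using I_l[OF that, of "c \<bullet> bas []"] by simp
  have I_zero: "0 \<in> I"
    using I_scl[OF rel, of 0] by simp
  have I_sum: "(\<Sum>i\<in>A. f i) \<in> I" if "\<And>i. i \<in> A \<Longrightarrow> f i \<in> I" for A and f :: "'i \<Rightarrow> _"
    using that by (induction A rule: infinite_finite_induct) (auto intro: I_add I_zero)
  let ?Y = "\<lambda>b. replicate b JY"
  \<comment> \<open>Moving \<open>JX\<close> past b letters \<open>JY\<close> costs b times the word
    of b + 1 letters \<open>JY\<close>. The step adds the relator times that word to
    \<open>JY\<close> times the previous case.\<close>
  have XY: "bas (JX # ?Y b) - bas (?Y b @ [JX]) - of_nat b \<bullet> bas (?Y (Suc b)) \<in> I" for b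
  proof (induction b)
    case (Suc b)
    from I_add[OF I_r[OF rel, of "bas (?Y b)"] I_l[OF Suc, of "bas [JY]"]]
    show ?case
      by (simp add: jordan_relator_def scl_add_left algebra_simps)
  qed (simp add: I_zero)
  \<comment> \<open>The 2 in the image 2 Z of \<open>JX\<close> cancels one of the c + 1 halvings
    made by \<open>jsec\<close>.\<close>
  have half: "2 * (1 / 2 ^ Suc c) = (1 / 2 ^ c :: 'k)" for c by simp
  \<comment> \<open>Modulo the ideal, \<open>jsec\<close> intertwines a letter with its operator on
    \<open>jcoord\<close>; induction on words then gives the normal form.\<close>
  have step: "fmult (bas [g]) (jsec q) - jsec (jgen_op g q) \<in> I" if "q \<in> jcoord" for g q
  proof -
    have bas: "fmult (bas [g]) (jsec (bas (b, c, 0))) - jsec (jgen_op g (bas (b, c, 0) :: 'k pbw)) \<in> I" for b c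
    proof (cases g)
      case JX
      have "fmult (bas [g]) (jsec (bas (b, c, 0))) - jsec (jgen_op g (bas (b, c, 0) :: 'k pbw)) =
         (1 / 2 ^ c) \<bullet> fmult (bas (JX # ?Y b) - bas (?Y b @ [JX]) - of_nat b \<bullet> bas (?Y (Suc b))) (bas (replicate c JX))"
        by (simp add: JX LZ_bas jsec_bas scl_add_right scl_diff_right half replicate_append_same mult.commute)
      then show ?thesis by (simp only: I_scl I_r XY)
    next
      case JY
      then show ?thesis by (simp add: LY_bas jsec_bas I_zero)
    qed
    have lin: "lin (\<lambda>q. fmult (bas [g]) (jsec q) - jsec (jgen_op g q))"
      by (cases g) (simp_all add: lin_def scl_add_right scl_diff_right mult.commute)
    have "fmult (bas [g]) (jsec q) - jsec (jgen_op g q) =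
        lext (\<lambda>i. fmult (bas [g]) (jsec (bas i)) - jsec (jgen_op g (bas i))) q"
      by (rule lin_eq_lext[OF lin])
    also have "\<dots> \<in> I"
      unfolding lext_def
    proof (intro I_sum I_scl)
      fix i assume "i \<in> Poly_Mapping.keys q"
      then have "snd (snd i) = 0" using that by (auto simp: jcoord_def)
      then show "fmult (bas [g]) (jsec (bas i)) - jsec (jgen_op g (bas i)) \<in> I"
        using bas[of "fst i" "fst (snd i)"] by (metis prod.collapse)
    qed
    finally show ?thesis .
  qed
  have word: "bas w - jsec (jword w) \<in> I" for w
  proof (induction w)
    case Nil
    show ?case by (simp add: pbw_one_def jsec_bas I_zero)
  next
    case (Cons g w)
    from I_add[OF I_l[OF Cons, of "bas [g]"] step[OF jword_jcoord, of g w]]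
    show ?case by simp
  qed
  show "?K \<subseteq> I"
  proof
    fix p assume "p \<in> ?K"
    then have "p = p - jsec (jhom p)" by simp
    also have "\<dots> = lext (\<lambda>w. bas w - jsec (jhom (bas w))) p"
      by (rule lin_eq_lext) (simp add: lin_def scl_diff_right)
    also have "\<dots> \<in> I"
      unfolding lext_def using word by (intro I_sum I_scl) simp
    finally show "p \<in> I" .
  qed
qed

lemma jordan_plane_eq:
  "jordan_plane = quotient_algebra free_algebra {p :: jordan_gen list \<Rightarrow>\<^sub>0 'k::field_char_0. jhom p = 0}"
proof -
  have "jordan_plane = quotient_algebra free_algebra
      (Idl\<^bsub>free_algebra\<^esub> {jordan_relator :: jordan_gen list \<Rightarrow>\<^sub>0 'k})"
    by (simp add: jordan_plane_def Let_def minus_free_algebra free_gen_def jordan_relator_def)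
  then show ?thesis by (simp add: jordan_ideal)
qed

lemma range_jhom: "range jhom = (jcoord :: 'k::field_char_0 pbw set)"
proof
  have "jhom p \<in> jcoord" for p :: "jordan_gen list \<Rightarrow>\<^sub>0 'k"
    by (induction p rule: poly_mapping_linear_induct)
      (simp_all add: jword_jcoord jcoord_add jcoord_scl)
  then show "range jhom \<subseteq> (jcoord :: 'k pbw set)" by auto
  show "jcoord \<subseteq> (range jhom :: 'k pbw set)"
  proof
    fix p :: "'k pbw" assume "p \<in> jcoord"
    then show "p \<in> range jhom"
    proof (induction p rule: jcoord_induct)
      case one
      show ?case by (rule range_eqI[of _ _ "bas []"]) simp
    next
      case (add p q)
      then show ?case by (auto simp flip: jhom_simps)
    next
      case (scale c p)
      then show ?case by (auto simp flip: jhom_simps)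
    next
      case (Y p)
      then obtain u where "p = jhom u" by auto
      then show ?case by (intro range_eqI[of _ _ "fmult (bas [JY]) u"]) (simp add: jhom_fmult)
    next
      case (Z p)
      then obtain u where "p = jhom u" by auto
      then show ?case
        by (intro range_eqI[of _ _ "(1 / 2) \<bullet> fmult (bas [JX]) u"]) (simp add: jhom_fmult)
    qed
  qed
qed

text \<open>The first isomorphism theorem for rings gives the ring isomorphism. Scalar
  multiplication is extra structure on the quotient, so its compatibility is checked
  separately.\<close>

lemma jordan_plane_iso:
  "algebra_isomorphic jordan_plane ((hopf_B :: ('k::field_char_0, _) module)\<lparr>carrier := jset\<rparr>)"
proof -
  let ?F = "free_algebra :: ('k, jordan_gen list \<Rightarrow>\<^sub>0 'k) module"
  let ?H = "hopf_B :: ('k, _) module"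
  let ?T = "?H\<lparr>carrier := jset\<rparr>"
  let ?J = "jordan_plane :: ('k, _) module"
  let ?h = "\<lambda>p. hvec (jhom p)"
  let ?K = "{p :: jordan_gen list \<Rightarrow>\<^sub>0 'k. jhom p = 0}"
  let ?f = "\<lambda>Q. the_elem (?h ` Q)"
  interpret h: ring_hom_ring ?F ?H ?h
    by (rule ring_hom_ringI[OF ring_free_algebra ring_hopf_B]) (simp_all add: jhom_fmult)
  have hvec_0: "hvec p = 0 \<longleftrightarrow> p = 0" for p :: "'k pbw"
    by (metis hcoord_hvec lin_zero[OF lin_hcoord] lin_zero[OF lin_hvec])
  have K: "a_kernel ?F ?H ?h = ?K"
    by (simp only: a_kernel_def' free_algebra_simps hopf_B_simps hvec_0 UNIV_I simp_thms)
  have "?h ` carrier ?F = hvec ` jcoord"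
    by (simp only: free_algebra_simps image_image flip: range_jhom)
  also have "\<dots> = jset"
    by (auto simp: jset_def image_iff) (metis hvec_hcoord)
  finally have T: "?h ` carrier ?F = jset" .
  have "?f \<in> ring_iso (?F Quot ?K) ?T"
    using h.FactRing_iso_set_aux unfolding K T .
  then have iso: "?f \<in> ring_iso jordan_plane ?T"
    by (simp add: jordan_plane_eq ring_iso_def ring_hom_def quotient_algebra_def)
  \<comment> \<open>The map is constant on cosets of its kernel; this evaluates
    \<open>the_elem\<close> and the union over representatives in the scalar multiplication.\<close>
  have h_coset: "?h ` (?K +>\<^bsub>?F\<^esub> p) = {?h p}" for p
    by (auto simp: a_r_coset_def r_coset_def image_iff intro!: exI[of _ 0])
  have "linear_map ?J ?T ?f"
    unfolding linear_map_def
  proof (intro conjI allI ballI)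
    show "?f \<in> carrier ?J \<rightarrow> carrier ?T"
      using iso by (auto simp: ring_iso_def ring_hom_def)
  next
    fix P Q assume "P \<in> carrier ?J" "Q \<in> carrier ?J"
    then show "?f (P \<oplus>\<^bsub>?J\<^esub> Q) = ?f P \<oplus>\<^bsub>?T\<^esub> ?f Q"
      using iso by (auto simp: ring_iso_def ring_hom_def)
  next
    fix c P assume "P \<in> carrier ?J"
    then obtain p where P: "P = ?K +>\<^bsub>?F\<^esub> p"
      by (auto simp: jordan_plane_eq quotient_algebra_def FactRing_def A_RCOSETS_def RCOSETS_def a_r_coset_def)
    have "?h ` (c \<odot>\<^bsub>?J\<^esub> P) = (\<Union>x\<in>P. ?h ` (?K +>\<^bsub>?F\<^esub> (c \<bullet> x)))"
      by (simp add: jordan_plane_eq quotient_algebra_def image_UN)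
    also have "\<dots> = (\<lambda>x. c \<bullet> x) ` ?h ` P"
      by (auto simp: h_coset)
    finally show "?f (c \<odot>\<^bsub>?J\<^esub> P) = c \<odot>\<^bsub>?T\<^esub> ?f P"
      by (simp add: P h_coset)
  qed
  then show ?thesis
    using iso unfolding algebra_isomorphic_def by blast
qed

theorem mainTheorem6:
  shows "\<exists>(H :: ('k::{alg_closed_field, field_char_0}, nat list \<Rightarrow>\<^sub>0 'k) module) \<Delta> \<epsilon> S T.
    hopf_algebra H \<Delta> \<epsilon> S \<and> connected_hopf H \<Delta> \<and> GKdim H = 3 \<and>
    coideal_subalgebra H \<Delta> T \<and>
    algebra_isomorphic jordan_plane (H\<lparr>carrier := T\<rparr>)"
  using hopf_B_hopf_algebra hopf_B_connected GKdim_hopf_B coideal_jset jordan_plane_iso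
  by blast

end
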